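(* Let $\pi:X\to Y$ be a strongly inductive covering of finite degree, and let $j:V\hookrightarrow Y$ be the inclusion of a path-connected subset. The preimage $\pi^{-1}(V)$ is path-connected if and only if $$j_*H_1(V)+\pi_*(H_1(X))=H_1(Y).$$
   Context: All homology is singular with integer coefficients. A covering of path-connected topological spaces $\pi:X\to Y$ is inductive if the natural embedding $\pi_1'(X)\to\pi_1'(Y)$ of commutator subgroups of the fundamental groups is an isomorphism; in this case $\pi_*:H_1(X)\to H_1(Y)$ is injective. An inductive covering is strongly inductive if moreover the induced embedding of torsion subgroups $H_1^T(X)\to H_1^T(Y)$ is an isomorphism. *)

theory Defs
  imports "HOL-Homology.Homology"
begin

text \<open>
  A topological space is a subset of a type of class \<open>topological_space\<close>, with the subspace
  topology. This is the setting of the library notions \<^const>\<open>covering_space\<close>,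
  \<^const>\<open>path_connected\<close> and \<^const>\<open>homotopic_paths\<close>; singular homology is that of
  \<open>top_of_set S\<close>. Spaces are not assumed to be Hausdorff or locally path-connected.
\<close>

section \<open>The fundamental group\<close>

definition based_loops :: "'a::topological_space set \<Rightarrow> 'a \<Rightarrow> (real \<Rightarrow> 'a) set" where
  "based_loops S a =
     {g. path g \<and> path_image g \<subseteq> S \<and> pathstart g = a \<and> pathfinish g = a}"

definition path_class :: "'a::topological_space set \<Rightarrow> (real \<Rightarrow> 'a) \<Rightarrow> (real \<Rightarrow> 'a) set" where
  "path_class S g = {h. homotopic_paths S g h}"

text \<open>
  The unions below are operations on classes written without choosing representatives: all the
  classes that are united coincide (lemmas \<open>fundamental_group_mult\<close> and \<open>pi1_map_class\<close>).
\<close>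

definition fundamental_group ::
    "'a::topological_space set \<Rightarrow> 'a \<Rightarrow> (real \<Rightarrow> 'a) set monoid" where
  "fundamental_group S a =
     \<lparr>carrier = path_class S ` based_loops S a,
      monoid.mult = (\<lambda>A B. \<Union>g\<in>A. \<Union>h\<in>B. path_class S (g +++ h)),
      one = path_class S (\<lambda>_. a)\<rparr>"

definition pi1_map ::
    "'b::topological_space set \<Rightarrow> ('a \<Rightarrow> 'b) \<Rightarrow> (real \<Rightarrow> 'a) set \<Rightarrow> (real \<Rightarrow> 'b) set" where
  "pi1_map T f A = (\<Union>g\<in>A. path_class T (f \<circ> g))"

lemma path_class_eq_iff:
  assumes "path g" "path_image g \<subseteq> S"
  shows "path_class S g = path_class S h \<longleftrightarrow> homotopic_paths S g h"
proof
  assume "path_class S g = path_class S h"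
  moreover have "g \<in> path_class S g"
    using assms by (simp add: path_class_def)
  ultimately show "homotopic_paths S g h"
    by (simp add: path_class_def homotopic_paths_sym)
next
  assume "homotopic_paths S g h"
  then show "path_class S g = path_class S h"
    unfolding path_class_def by (blast intro: homotopic_paths_trans homotopic_paths_sym)
qed

lemma based_loops_join:
  "g \<in> based_loops S a \<Longrightarrow> h \<in> based_loops S a \<Longrightarrow> g +++ h \<in> based_loops S a"
  by (simp add: based_loops_def subset_path_image_join)

lemma based_loops_const: "a \<in> S \<Longrightarrow> (\<lambda>_. a) \<in> based_loops S a"
  by (auto simp: based_loops_def path_def path_image_def pathstart_def pathfinish_def)

lemma based_loops_reverse: "g \<in> based_loops S a \<Longrightarrow> reversepath g \<in> based_loops S a"
  by (simp add: based_loops_def)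

lemma fundamental_group_mult:
  assumes g: "g \<in> based_loops S a" and h: "h \<in> based_loops S a"
  shows "path_class S g \<otimes>\<^bsub>fundamental_group S a\<^esub> path_class S h = path_class S (g +++ h)"
proof -
  have eq: "path_class S (g' +++ h') = path_class S (g +++ h)"
    if "g' \<in> path_class S g" "h' \<in> path_class S h" for g' h'
  proof -
    have "homotopic_paths S (g +++ h) (g' +++ h')"
      using that g h by (intro homotopic_paths_join) (auto simp: path_class_def based_loops_def)
    then show ?thesis
      using based_loops_join[OF g h] path_class_eq_iff[of "g +++ h" S "g' +++ h'"]
      by (simp add: based_loops_def)
  qed
  have "g \<in> path_class S g" "h \<in> path_class S h"
    using g h by (auto simp: path_class_def based_loops_def)
  then have "(\<Union>g'\<in>path_class S g. \<Union>h'\<in>path_class S h. path_class S (g' +++ h')) =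
      path_class S (g +++ h)"
    using eq by blast
  then show ?thesis
    by (simp add: fundamental_group_def)
qed

lemma homotopic_paths_const_right:
  assumes "path p" "path_image p \<subseteq> S" "pathfinish p = a"
  shows "homotopic_paths S (p +++ (\<lambda>_. a)) p"
proof -
  let ?f = "\<lambda>t::real. if t \<le> 1/2 then 2 *\<^sub>R t else 1"
  have "continuous_on {0..1} ?f"
    unfolding split_01
    by (rule continuous_on_cases continuous_intros | force simp: pathfinish_def joinpaths_def)+
  moreover have "(p +++ (\<lambda>_. a)) t = p (?f t)" for t
    using assms(3) by (simp add: joinpaths_def pathfinish_def)
  ultimately have "homotopic_paths S p (p +++ (\<lambda>_. a))"
    using assms(1,2) by (intro homotopic_paths_reparametrize[where f = ?f]) auto
  then show ?thesis
    by (rule homotopic_paths_sym)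
qed

lemma homotopic_paths_const_left:
  assumes "path p" "path_image p \<subseteq> S" "pathstart p = a"
  shows "homotopic_paths S ((\<lambda>_. a) +++ p) p"
proof -
  have "homotopic_paths S (reversepath p +++ (\<lambda>_. a)) (reversepath p)"
    using assms by (intro homotopic_paths_const_right) auto
  then have "homotopic_paths S (reversepath (reversepath p +++ (\<lambda>_. a))) p"
    using homotopic_paths_reversepath_D by fastforce
  moreover have "reversepath (reversepath p +++ (\<lambda>_. a)) = (\<lambda>_. a) +++ p"
    using assms reversepath_joinpaths[of "reversepath p" "\<lambda>_. a"]
    by (simp add: pathstart_def) (simp add: reversepath_def)
  ultimately show ?thesis by simp
qed

lemma homotopic_paths_reverse_right:
  assumes "path p" "path_image p \<subseteq> S" "pathstart p = a"
  shows "homotopic_paths S (p +++ reversepath p) (\<lambda>_. a)"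
proof -
  have p: "continuous_on {0..1} p"
    using assms by (auto simp: path_def)
  let ?A = "{0..1::real} \<times> {0..1::real}"
  let ?h = "\<lambda>y::real \<times> real. ((\<lambda>t. p (fst y * t)) +++ reversepath (\<lambda>t. p (fst y * t))) (snd y)"
  have "continuous_on ?A ?h"
    unfolding joinpaths_def reversepath_def
  proof (rule continuous_on_cases_le)
    show "continuous_on {x \<in> ?A. snd x \<le> 1/2} (\<lambda>t. p (fst t * (2 * snd t)))"
         "continuous_on {x \<in> ?A. 1/2 \<le> snd x} (\<lambda>t. p (fst t * (1 - (2 * snd t - 1))))"
         "continuous_on ?A snd"
      by (intro continuous_on_compose2 [OF p] continuous_intros; auto simp: mult_le_one)+
  qed (auto simp: algebra_simps)
  then show ?thesis
    using assms
    apply (subst homotopic_paths_sym_eq)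
    unfolding homotopic_paths_def homotopic_with_def
    apply (rule_tac x="?h" in exI)
    apply (force simp: mult_le_one path_defs joinpaths_def reversepath_def)
    done
qed

lemma group_fundamental_group:
  assumes "a \<in> S"
  shows "group (fundamental_group S a)"
proof (rule groupI)
  let ?G = "fundamental_group S a"
  have carrier: "carrier ?G = path_class S ` based_loops S a"
    and one: "\<one>\<^bsub>?G\<^esub> = path_class S (\<lambda>_. a)"
    by (simp_all add: fundamental_group_def)
  have eqI: "path_class S g = path_class S h" if "homotopic_paths S g h" for g h
    using that path_class_eq_iff homotopic_paths_imp_path homotopic_paths_imp_subset by metis
  note const = based_loops_const[OF assms]
  show "x \<otimes>\<^bsub>?G\<^esub> y \<in> carrier ?G" if "x \<in> carrier ?G" "y \<in> carrier ?G" for x y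
    using that by (auto simp: carrier fundamental_group_mult intro: based_loops_join)
  show "\<one>\<^bsub>?G\<^esub> \<in> carrier ?G"
    using const by (auto simp: carrier one)
  show "x \<otimes>\<^bsub>?G\<^esub> y \<otimes>\<^bsub>?G\<^esub> z = x \<otimes>\<^bsub>?G\<^esub> (y \<otimes>\<^bsub>?G\<^esub> z)"
    if "x \<in> carrier ?G" "y \<in> carrier ?G" "z \<in> carrier ?G" for x y z
  proof -
    obtain f g h where fgh: "f \<in> based_loops S a" "g \<in> based_loops S a" "h \<in> based_loops S a"
      and x: "x = path_class S f" "y = path_class S g" "z = path_class S h"
      using \<open>x \<in> _\<close> \<open>y \<in> _\<close> \<open>z \<in> _\<close> by (auto simp: carrier)
    have "homotopic_paths S (f +++ (g +++ h)) ((f +++ g) +++ h)"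
      using fgh by (intro homotopic_paths_assoc) (auto simp: based_loops_def)
    from eqI[OF this] show ?thesis
      using fgh by (simp add: x fundamental_group_mult based_loops_join)
  qed
  show "\<one>\<^bsub>?G\<^esub> \<otimes>\<^bsub>?G\<^esub> x = x" if "x \<in> carrier ?G" for x
  proof -
    obtain f where f: "f \<in> based_loops S a" and x: "x = path_class S f"
      using \<open>x \<in> _\<close> by (auto simp: carrier)
    have "homotopic_paths S ((\<lambda>_. a) +++ f) f"
      using f by (intro homotopic_paths_const_left) (auto simp: based_loops_def)
    from eqI[OF this] show ?thesis
      using f const by (simp add: x one fundamental_group_mult)
  qed
  show "\<exists>y\<in>carrier ?G. y \<otimes>\<^bsub>?G\<^esub> x = \<one>\<^bsub>?G\<^esub>" if "x \<in> carrier ?G" for x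
  proof -
    obtain f where f: "f \<in> based_loops S a" and x: "x = path_class S f"
      using \<open>x \<in> _\<close> by (auto simp: carrier)
    have r: "reversepath f \<in> based_loops S a"
      using f by (rule based_loops_reverse)
    have "homotopic_paths S (reversepath f +++ reversepath (reversepath f)) (\<lambda>_. a)"
      using f by (intro homotopic_paths_reverse_right) (auto simp: based_loops_def)
    from eqI[OF this] have "path_class S (reversepath f) \<otimes>\<^bsub>?G\<^esub> x = \<one>\<^bsub>?G\<^esub>"
      using f r by (simp add: x one fundamental_group_mult)
    then show ?thesis
      using r by (auto simp: carrier)
  qed
qed

lemma pi1_map_class:
  assumes f: "continuous_on S f" "f ` S \<subseteq> T" and g: "g \<in> based_loops S a"
  shows "pi1_map T f (path_class S g) = path_class T (f \<circ> g)"
proof -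
  have "path_class T (f \<circ> h) = path_class T (f \<circ> g)" if "h \<in> path_class S g" for h
  proof -
    have "homotopic_paths S h g"
      using that by (simp add: path_class_def homotopic_paths_sym)
    then have "homotopic_paths T (f \<circ> h) (f \<circ> g)"
      using f by (intro homotopic_paths_continuous_image) auto
    then show ?thesis
      using path_class_eq_iff homotopic_paths_imp_path homotopic_paths_imp_subset by metis
  qed
  moreover have "g \<in> path_class S g"
    using g by (simp add: path_class_def based_loops_def)
  ultimately show ?thesis
    unfolding pi1_map_def by blast
qed

lemma pi1_map_hom:
  assumes f: "continuous_on S f" "f ` S \<subseteq> T"
  shows "pi1_map T f \<in> hom (fundamental_group S a) (fundamental_group T (f a))"
proof (rule homI)
  let ?G = "fundamental_group S a" and ?H = "fundamental_group T (f a)"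
  have carrier: "carrier ?G = path_class S ` based_loops S a"
    "carrier ?H = path_class T ` based_loops T (f a)"
    by (simp_all add: fundamental_group_def)
  have comp: "f \<circ> g \<in> based_loops T (f a)" if "g \<in> based_loops S a" for g
    using that f continuous_on_subset[OF f(1)]
    by (auto simp: based_loops_def path_image_compose pathstart_compose pathfinish_compose
        intro!: path_continuous_image)
  show "pi1_map T f x \<in> carrier ?H" if "x \<in> carrier ?G" for x
    using that comp by (auto simp: carrier pi1_map_class[OF f])
  show "pi1_map T f (x \<otimes>\<^bsub>?G\<^esub> y) = pi1_map T f x \<otimes>\<^bsub>?H\<^esub> pi1_map T f y"
    if "x \<in> carrier ?G" "y \<in> carrier ?G" for x y
  proof -
    obtain g h where gh: "g \<in> based_loops S a" "h \<in> based_loops S a"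
      and x: "x = path_class S g" "y = path_class S h"
      using \<open>x \<in> _\<close> \<open>y \<in> _\<close> by (auto simp: carrier)
    show ?thesis
      using gh based_loops_join[OF gh]
      by (simp add: x fundamental_group_mult comp pi1_map_class[OF f] path_compose_join)
  qed
qed

definition commutator_subgroup :: "('a, 'm) monoid_scheme \<Rightarrow> ('a, 'm) monoid_scheme" where
  "commutator_subgroup G = G\<lparr>carrier := derived G (carrier G)\<rparr>"

section \<open>First homology\<close>

abbreviation H1 :: "'a::topological_space set \<Rightarrow> 'a chain set monoid" where
  "H1 S \<equiv> homology_group 1 (top_of_set S)"

abbreviation H1_map :: "'a::topological_space set \<Rightarrow> 'b::topological_space set \<Rightarrow> ('a \<Rightarrow> 'b) \<Rightarrow>
    'a chain set \<Rightarrow> 'b chain set" where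
  "H1_map S T f \<equiv> hom_induced 1 (top_of_set S) {} (top_of_set T) {} f"

text \<open>The torsion elements; the library writes abelian groups multiplicatively.\<close>

definition torsion_subgroup :: "('a, 'm) monoid_scheme \<Rightarrow> ('a, 'm) monoid_scheme" where
  "torsion_subgroup G =
     G\<lparr>carrier := {x \<in> carrier G. \<exists>n::nat. n > 0 \<and> x [^]\<^bsub>G\<^esub> n = \<one>\<^bsub>G\<^esub>}\<rparr>"

section \<open>Inductive coverings\<close>

text \<open>
  Path-connected spaces are nonempty by convention; here \<open>\<exists>x\<in>X\<close> ensures this for \<open>X\<close> and hence
  for \<open>Y\<close>. As \<open>X\<close> is path-connected, the condition on the commutator subgroups does not depend
  on the base point.
\<close>

definition inductive_covering ::
    "'a::topological_space set \<Rightarrow> ('a \<Rightarrow> 'b::topological_space) \<Rightarrow> 'b set \<Rightarrow> bool" where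
  "inductive_covering X \<pi> Y \<longleftrightarrow>
     path_connected X \<and> path_connected Y \<and> covering_space X \<pi> Y \<and>
     (\<exists>x\<in>X. pi1_map Y \<pi> \<in> iso (commutator_subgroup (fundamental_group X x))
                              (commutator_subgroup (fundamental_group Y (\<pi> x))))"

definition strongly_inductive_covering ::
    "'a::topological_space set \<Rightarrow> ('a \<Rightarrow> 'b::topological_space) \<Rightarrow> 'b set \<Rightarrow> bool" where
  "strongly_inductive_covering X \<pi> Y \<longleftrightarrow>
     inductive_covering X \<pi> Y \<and>
     H1_map X Y \<pi> \<in> iso (torsion_subgroup (H1 X)) (torsion_subgroup (H1 Y))"

definition finite_degree ::
    "'a set \<Rightarrow> ('a \<Rightarrow> 'b) \<Rightarrow> 'b set \<Rightarrow> bool" where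
  "finite_degree X \<pi> Y \<longleftrightarrow>
     (\<exists>d. \<forall>y\<in>Y. finite (X \<inter> \<pi> -` {y}) \<and> card (X \<inter> \<pi> -` {y}) = d)"

end

theory Submission
  imports Defs
begin

text \<open>
  Fix a point \<open>v\<close> of \<open>V\<close>. Paths in \<open>V\<close> lift to paths in its preimage in \<open>X\<close>, so every point of the preimage can be
  moved into the fibre over \<open>v\<close>, and the preimage is path-connected if and only if the loops of \<open>V\<close> at \<open>v\<close>
  act transitively on this fibre. Since \<open>X\<close> is path-connected, all loops of \<open>Y\<close> act transitively. The
  question is thus whether each loop of \<open>Y\<close> equals a loop of \<open>V\<close> up to loops with closed lifts.

  For an inductive covering this can be decided in homology. Every element of the commutator subgroup
  of \<open>\<pi>\<^sub>1(Y)\<close> comes from \<open>\<pi>\<^sub>1(X)\<close>, hence lifts to a closed loop, and by the Hurewicz theorem in degree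
  one the commutator subgroup is exactly the set of null-homologous loops. So null-homologous loops
  have closed lifts (\<open>inductive_covering_null_homologous_loop_lifts\<close>).

  Suppose that the preimage of \<open>V\<close> is path-connected. A class in \<open>H\<^sub>1(Y)\<close> is the class of a loop \<open>g\<close> at \<open>v\<close>. A lift \<open>k\<close>
  of \<open>g\<close> has both ends in the preimage of \<open>V\<close>, and can be closed up there by a path \<open>q\<close>. Then \<open>[g]\<close> is
  \<open>[\<pi> \<circ> (k +++ q)] - [\<pi> \<circ> q]\<close>, the image of a class of \<open>X\<close> minus that of a class of \<open>V\<close>.

  Conversely, let \<open>p\<close> and \<open>p'\<close> lie over \<open>v\<close> and let \<open>r\<close> be a path in \<open>X\<close> that joins them. By hypothesis
  \<open>[\<pi> \<circ> r] = [f] + [\<pi> \<circ> g]\<close> for loops \<open>f\<close> of \<open>V\<close> at \<open>v\<close> and \<open>g\<close> of \<open>X\<close> at \<open>p\<close>. The loop that runs back along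
  \<open>f\<close> and \<open>\<pi> \<circ> g\<close> and then along \<open>\<pi> \<circ> r\<close> is null-homologous, so its lifts are closed. Its lift from the
  end of the lift \<open>k\<close> of \<open>f\<close> at \<open>p\<close> goes back along \<open>k\<close> to \<open>p\<close>, around \<open>g\<close>, and along \<open>r\<close> to \<open>p'\<close>.
  Hence \<open>k\<close>, a path in the preimage of \<open>V\<close>, ends at \<open>p'\<close>.

  The proof rests on two bodies of facts. Path lifting and monodromy are needed for coverings of
  arbitrary topological spaces and are derived from local lifting of families of paths by bisection.
  The Hurewicz theorem is split into \<open>hurewicz_surjective\<close> and \<open>hurewicz_kernel\<close>; both rest on closing
  up paths to loops with a fixed choice of spanning paths from the base point.
\<close>

section \<open>Path lifting in coverings of topological spaces\<close>

text \<open>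
  The two facts about sheets that lifting needs: a sheet is an open homeomorphic copy of the evenly
  covered set, and distinct points of a fibre are separated by disjoint sheets. The second one
  takes the place of a Hausdorff hypothesis on \<open>X\<close>.
\<close>

lemma covering_space_evenly_covered:
  assumes "covering_space X \<pi> Y" "y \<in> Y"
  obtains V where "openin (top_of_set Y) V" "y \<in> V"
    and "\<And>x. x \<in> X \<Longrightarrow> \<pi> x \<in> V \<Longrightarrow>
      \<exists>U q. x \<in> U \<and> openin (top_of_set X) U \<and> homeomorphism U V \<pi> q"
    and "\<And>x x'. x \<in> X \<Longrightarrow> x' \<in> X \<Longrightarrow> \<pi> x \<in> V \<Longrightarrow> \<pi> x = \<pi> x' \<Longrightarrow> x \<noteq> x' \<Longrightarrow>
      \<exists>U U'. x \<in> U \<and> x' \<in> U' \<and> openin (top_of_set X) U \<and> openin (top_of_set X) U' \<and> U \<inter> U' = {}"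
proof -
  obtain V v where V: "y \<in> V" "openin (top_of_set Y) V" "\<Union>v = X \<inter> \<pi> -` V"
      and v: "\<And>u. u \<in> v \<Longrightarrow> openin (top_of_set X) u" "pairwise disjnt v"
        "\<And>u. u \<in> v \<Longrightarrow> \<exists>q. homeomorphism u V \<pi> q"
    using assms unfolding covering_space_def by metis
  show ?thesis
  proof
    show "openin (top_of_set Y) V" "y \<in> V" by fact+
    show "\<exists>U q. x \<in> U \<and> openin (top_of_set X) U \<and> homeomorphism U V \<pi> q"
      if "x \<in> X" "\<pi> x \<in> V" for x
    proof -
      from that V(3) obtain U where "U \<in> v" "x \<in> U" by blast
      with v show ?thesis by blast
    qed
  next
    fix x x' assume x: "x \<in> X" "x' \<in> X" "\<pi> x \<in> V" "\<pi> x = \<pi> x'" "x \<noteq> x'"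
    with V(3) have "x \<in> \<Union>v" "x' \<in> \<Union>v" by auto
    then obtain U U' where U: "U \<in> v" "x \<in> U" "U' \<in> v" "x' \<in> U'" by blast
    have "inj_on \<pi> U"
      using v(3)[OF U(1)] by (metis homeomorphism_apply1 inj_onI)
    then have "U \<noteq> U'"
      using x U by (auto dest: inj_onD)
    then have "U \<inter> U' = {}"
      using v(2) U by (auto simp: pairwise_def disjnt_def)
    with U v(1) show "\<exists>U U'. x \<in> U \<and> x' \<in> U' \<and> openin (top_of_set X) U \<and> openin (top_of_set X) U' \<and>
        U \<inter> U' = {}"
      by blast
  qed
qed

lemma path_near_in_openin:
  assumes k: "path k" "path_image k \<subseteq> X" and U: "openin (top_of_set X) U" 
    and t: "t \<in> {0..1}" "k t \<in> U"
  obtains d where "d > 0" "\<And>s. s \<in> {0..1} \<Longrightarrow> \<bar>s - t\<bar> < d \<Longrightarrow> k s \<in> U"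
proof -
  have "openin (top_of_set {0..1}) ({0..1} \<inter> k -` U)"
    using k U by (intro continuous_openin_preimage[of _ _ X]) (auto simp: path_def path_image_def)
  then obtain d where "d > 0" "ball t d \<inter> {0..1} \<subseteq> {0..1} \<inter> k -` U"
    using t by (metis IntI openin_contains_ball vimageI)
  then show ?thesis
    by (intro that[of d]) (auto simp: dist_real_def abs_minus_commute subset_iff)
qed

text \<open>
  Near each parameter the two lifts run either in one sheet, where \<open>\<pi>\<close> is injective, or in two
  disjoint sheets. So whether they agree is locally constant in the parameter.
\<close>

lemma covering_space_path_lifts_eq:
  assumes cov: "covering_space X \<pi> Y"
    and k: "path k" "path_image k \<subseteq> X" and l: "path l" "path_image l \<subseteq> X"
    and eq: "\<And>t. t \<in> {0..1} \<Longrightarrow> \<pi> (k t) = \<pi> (l t)"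
    and start: "pathstart k = pathstart l" and t: "t \<in> {0..1}"
  shows "k t = l t"
proof -
  let ?P = "\<lambda>a b. 0 \<le> a \<and> b \<le> 1 \<longrightarrow> (k a = l a \<longleftrightarrow> k b = l b)"
  have "0 \<le> t" using t by simp
  then have "?P 0 t"
  proof (induction rule: Bolzano[where P = ?P])
    case (trans a b c)
    then show ?case by auto
  next
    case (local s)
    then have s: "s \<in> {0..1}" using t by simp
    have kl: "k s \<in> X" "l s \<in> X" "\<pi> (k s) \<in> Y"
      using k(2) l(2) s covering_space_imp_surjective[OF cov] by (force simp: path_image_def)+
    obtain V where "openin (top_of_set Y) V" and V: "\<pi> (k s) \<in> V"
      and sheet: "\<And>x. x \<in> X \<Longrightarrow> \<pi> x \<in> V \<Longrightarrow>
        \<exists>U q. x \<in> U \<and> openin (top_of_set X) U \<and> homeomorphism U V \<pi> q"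
      and disj: "\<And>x x'. x \<in> X \<Longrightarrow> x' \<in> X \<Longrightarrow> \<pi> x \<in> V \<Longrightarrow> \<pi> x = \<pi> x' \<Longrightarrow> x \<noteq> x' \<Longrightarrow>
        \<exists>U U'. x \<in> U \<and> x' \<in> U' \<and> openin (top_of_set X) U \<and> openin (top_of_set X) U' \<and> U \<inter> U' = {}"
      using covering_space_evenly_covered[OF cov kl(3)] by blast
    have "\<exists>U U'. k s \<in> U \<and> l s \<in> U' \<and> openin (top_of_set X) U \<and> openin (top_of_set X) U' \<and>
        (if k s = l s then U = U' \<and> inj_on \<pi> U else U \<inter> U' = {})"
    proof (cases "k s = l s")
      case True
      then show ?thesis
        using sheet[OF kl(1) V] by (metis homeomorphism_apply1 inj_onI)
    next
      case False
      then show ?thesis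
        using disj[OF kl(1,2) V eq[OF s]] by simp
    qed
    then obtain U U' where U: "k s \<in> U" "l s \<in> U'" "openin (top_of_set X) U" "openin (top_of_set X) U'"
      and UU: "if k s = l s then U = U' \<and> inj_on \<pi> U else U \<inter> U' = {}" by blast
    obtain d where d: "d > 0" "\<And>r. r \<in> {0..1} \<Longrightarrow> \<bar>r - s\<bar> < d \<Longrightarrow> k r \<in> U"
      using path_near_in_openin[OF k U(3) s U(1)] by blast
    obtain d' where d': "d' > 0" "\<And>r. r \<in> {0..1} \<Longrightarrow> \<bar>r - s\<bar> < d' \<Longrightarrow> l r \<in> U'"
      using path_near_in_openin[OF l U(4) s U(2)] by blast
    have near: "k r = l r \<longleftrightarrow> k s = l s" if "r \<in> {0..1}" "\<bar>r - s\<bar> < min d d'" for r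
      using UU d(2)[of r] d'(2)[of r] that eq[of r] by (auto split: if_splits dest: inj_onD)
    show ?case
    proof (intro exI[of _ "min d d'"] conjI allI impI)
      fix a b assume "a \<le> s \<and> s \<le> b \<and> b - a < min d d'" "0 \<le> a \<and> b \<le> 1"
      then show "k a = l a \<longleftrightarrow> k b = l b"
        using near[of a] near[of b] by auto
    qed (use d d' in auto)
  qed
  then show ?thesis
    using start t by (simp add: pathstart_def)
qed

text \<open>
  Lifting a whole family of paths at once, for parameters near \<open>w\<close>, gives both path lifting (one
  parameter) and monodromy (the parameter of a homotopy). On a short time interval the family stays
  in one evenly covered set for parameters near \<open>w\<close> and is lifted through the sheet that contains
  the initial point at \<open>w\<close>; bisection concatenates finitely many such steps, shrinking the
  parameter neighbourhood at each of them.
\<close>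

lemma covering_space_lift_path_family:
  fixes h :: "'c::topological_space \<times> real \<Rightarrow> 'b::topological_space"
    and X :: "'a::topological_space set"
  assumes cov: "covering_space X \<pi> Y"
    and h: "continuous_on (Z \<times> {0..1}) h" "h ` (Z \<times> {0..1}) \<subseteq> Y"
    and u: "continuous_on Z u" "u ` Z \<subseteq> X" "\<And>z. z \<in> Z \<Longrightarrow> \<pi> (u z) = h (z, 0)"
    and w: "w \<in> Z"
  obtains N K where "openin (top_of_set Z) N" "w \<in> N" "continuous_on (N \<times> {0..1}) K"
    "K ` (N \<times> {0..1}) \<subseteq> X" "\<And>z t. z \<in> N \<Longrightarrow> t \<in> {0..1} \<Longrightarrow> \<pi> (K (z, t)) = h (z, t)"
    "\<And>z. z \<in> N \<Longrightarrow> K (z, 0) = u z"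
proof -
  define start where "start a M u \<longleftrightarrow> openin (top_of_set Z) M \<and> w \<in> M \<and>
      continuous_on M u \<and> u ` M \<subseteq> X \<and> (\<forall>z\<in>M. \<pi> (u z) = h (z, a))" for a M u
  define lift where "lift a b u N K \<longleftrightarrow> openin (top_of_set Z) N \<and> w \<in> N \<and>
      continuous_on (N \<times> {a..b}) K \<and> K ` (N \<times> {a..b}) \<subseteq> X \<and>
      (\<forall>z\<in>N. \<forall>t\<in>{a..b}. \<pi> (K (z, t)) = h (z, t)) \<and> (\<forall>z\<in>N. K (z, a) = u z)" for a b u N K
  let ?P = "\<lambda>a b. 0 \<le> a \<and> a \<le> b \<and> b \<le> 1 \<longrightarrow>
      (\<forall>M u. start a M u \<longrightarrow> (\<exists>N\<subseteq>M. \<exists>K. lift a b u N K))"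
  have "(0::real) \<le> 1" by simp
  then have "?P 0 1"
  proof (induction rule: Bolzano[where P = ?P])
    case (trans a b c)
    show ?case
    proof (intro impI allI, elim conjE)
      fix M u assume ac: "0 \<le> a" "a \<le> c" "c \<le> 1" and M: "start a M u"
      have "\<exists>N\<subseteq>M. \<exists>K. lift a b u N K"
        using trans(1,3,4) ac M by auto
      then obtain N K where "N \<subseteq> M" and "lift a b u N K" by blast
      then have N: "openin (top_of_set Z) N" "w \<in> N" "N \<subseteq> M"
        and K: "continuous_on (N \<times> {a..b}) K" "K ` (N \<times> {a..b}) \<subseteq> X"
          "\<forall>z\<in>N. \<forall>t\<in>{a..b}. \<pi> (K (z, t)) = h (z, t)" "\<forall>z\<in>N. K (z, a) = u z"
        by (simp_all add: lift_def)
      have "continuous_on N (\<lambda>z. K (z, b))"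
        by (rule continuous_on_compose2[OF K(1)]) (use trans in \<open>auto intro!: continuous_intros\<close>)
      moreover have "(\<lambda>z. K (z, b)) ` N \<subseteq> X" "\<forall>z\<in>N. \<pi> (K (z, b)) = h (z, b)"
        using K(2,3) trans(3) by auto
      ultimately have "start b N (\<lambda>z. K (z, b))"
        using N by (simp add: start_def)
      then have "\<exists>N'\<subseteq>N. \<exists>L. lift b c (\<lambda>z. K (z, b)) N' L"
        using trans(2-4) ac by auto
      then obtain N' L where "N' \<subseteq> N" and "lift b c (\<lambda>z. K (z, b)) N' L" by blast
      then have N': "openin (top_of_set Z) N'" "w \<in> N'" "N' \<subseteq> N"
        and L: "continuous_on (N' \<times> {b..c}) L" "L ` (N' \<times> {b..c}) \<subseteq> X"
          "\<forall>z\<in>N'. \<forall>t\<in>{b..c}. \<pi> (L (z, t)) = h (z, t)" "\<forall>z\<in>N'. L (z, b) = K (z, b)"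
        by (simp_all add: lift_def)
      let ?J = "\<lambda>p. if snd p \<le> b then K p else L p"
      have "continuous_on (N' \<times> {a..c}) ?J"
      proof (rule continuous_on_cases_le)
        show "continuous_on {p \<in> N' \<times> {a..c}. snd p \<le> b} K"
          by (rule continuous_on_subset[OF K(1)]) (use N' in auto)
        show "continuous_on {p \<in> N' \<times> {a..c}. b \<le> snd p} L"
          by (rule continuous_on_subset[OF L(1)]) auto
      qed (use L(4) in \<open>auto intro!: continuous_intros\<close>)
      moreover have "?J ` (N' \<times> {a..c}) \<subseteq> X"
        using K(2) L(2) N'(3) by (force simp: image_subset_iff)
      moreover have "\<forall>z\<in>N'. \<forall>t\<in>{a..c}. \<pi> (?J (z, t)) = h (z, t)"
        using K(3) L(3) N'(3) by auto
      moreover have "\<forall>z\<in>N'. ?J (z, a) = u z"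
        using K(4) N'(3) trans(3) by auto
      ultimately have "lift a c u N' ?J"
        using N' by (simp add: lift_def)
      with N N' show "\<exists>N\<subseteq>M. \<exists>K. lift a c u N K" by blast
    qed
  next
    case (local x)
    then have x: "x \<in> {0..1}" by simp
    have "h (w, x) \<in> Y" using h(2) w x by auto
    then obtain V where V: "openin (top_of_set Y) V" "h (w, x) \<in> V"
      and sheet: "\<And>x. x \<in> X \<Longrightarrow> \<pi> x \<in> V \<Longrightarrow>
        \<exists>U q. x \<in> U \<and> openin (top_of_set X) U \<and> homeomorphism U V \<pi> q"
      by (rule covering_space_evenly_covered[OF cov]) blast
    have "openin (top_of_set (Z \<times> {0..1})) ((Z \<times> {0..1}) \<inter> h -` V)"
      using h V by (intro continuous_openin_preimage[of _ _ Y]) auto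
    then obtain O' where O': "open O'" "(Z \<times> {0..1}) \<inter> h -` V = (Z \<times> {0..1}) \<inter> O'"
      by (auto simp: openin_open)
    have "(w, x) \<in> (Z \<times> {0..1}) \<inter> h -` V" using V(2) w x by simp
    then have "(w, x) \<in> O'" unfolding O'(2) by simp
    then obtain A B where AB: "open A" "open B" "w \<in> A" "x \<in> B" "A \<times> B \<subseteq> O'"
      using open_prod_elim[OF O'(1)] by (metis mem_Sigma_iff)
    obtain d where d: "d > 0" "ball x d \<subseteq> B"
      using AB by (metis open_contains_ball)
    \<comment> \<open>one box around \<open>(w, x)\<close> is mapped into the evenly covered set\<close>
    have hV: "h (z, t) \<in> V" if "z \<in> Z \<inter> A" "t \<in> {0..1}" "\<bar>t - x\<bar> < d" for z t
    proof -
      have "t \<in> B" using that d(2) by (auto simp: dist_real_def subset_iff abs_minus_commute)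
      then have "(z, t) \<in> O'" using that(1) AB(5) by blast
      then have "(z, t) \<in> (Z \<times> {0..1}) \<inter> O'" using that(1,2) by simp
      then show ?thesis unfolding O'(2)[symmetric] by simp
    qed
    show ?case
    proof (intro exI[of _ d] conjI impI allI, fact d(1), elim conjE)
      fix a b M u assume ab: "a \<le> x" "x \<le> b" "b - a < d" "0 \<le> a" "a \<le> b" "b \<le> 1"
        and "start a M u"
      then have M: "openin (top_of_set Z) M" "w \<in> M"
        and u: "continuous_on M u" "u ` M \<subseteq> X" "\<forall>z\<in>M. \<pi> (u z) = h (z, a)"
        by (simp_all add: start_def)
      have hV': "h (z, t) \<in> V" if "z \<in> M \<inter> A" "t \<in> {a..b}" for z t
        using that ab hV[of z t] openin_imp_subset[OF M(1)] by auto
      have "u w \<in> X" "\<pi> (u w) \<in> V"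
        using u(2,3) M(2) hV'[of w a] AB(3) ab by auto
      then obtain U q where U: "u w \<in> U" "openin (top_of_set X) U" and q: "homeomorphism U V \<pi> q"
        using sheet by blast
      \<comment> \<open>the initial points over these parameters stay in the sheet \<open>U\<close>, so inverting \<open>\<pi>\<close> on \<open>U\<close> lifts from them\<close>
      define N where "N = (M \<inter> u -` U) \<inter> A"
      have MZ: "M \<subseteq> Z" using openin_imp_subset[OF M(1)] .
      have "openin (top_of_set M) (M \<inter> u -` U)"
        using u U by (intro continuous_openin_preimage[of _ _ X]) auto
      then have "openin (top_of_set Z) (M \<inter> u -` U)"
        using M(1) openin_trans by blast
      then have N: "openin (top_of_set Z) N"
        using AB(1) openin_Int_open unfolding N_def by blast
      moreover have "w \<in> N" "N \<subseteq> M" using M U AB by (auto simp: N_def)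
      moreover have "continuous_on (N \<times> {a..b}) (\<lambda>p. q (h p))"
      proof (rule continuous_on_compose2[of V q])
        show "continuous_on V q" using q by (simp add: homeomorphism_def)
        show "continuous_on (N \<times> {a..b}) h"
          by (rule continuous_on_subset[OF h(1)]) (use MZ ab in \<open>auto simp: N_def\<close>)
        show "h ` (N \<times> {a..b}) \<subseteq> V"
          using hV' by (auto simp: N_def)
      qed
      moreover have "(\<lambda>p. q (h p)) ` (N \<times> {a..b}) \<subseteq> X"
      proof -
        have "q ` V \<subseteq> X"
          using q openin_imp_subset[OF U(2)] by (simp add: homeomorphism_def)
        then show ?thesis
          using hV' by (auto simp: N_def image_subset_iff)
      qed
      moreover have "\<forall>z\<in>N. \<forall>t\<in>{a..b}. \<pi> (q (h (z, t))) = h (z, t)"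
        using hV' homeomorphism_apply2[OF q] by (auto simp: N_def)
      moreover have "\<forall>z\<in>N. q (h (z, a)) = u z"
      proof
        fix z assume "z \<in> N"
        then have "z \<in> M" "u z \<in> U" by (auto simp: N_def)
        then show "q (h (z, a)) = u z"
          using u(3) homeomorphism_apply1[OF q] by metis
      qed
      ultimately have "lift a b u N (\<lambda>p. q (h p))"
        by (simp add: lift_def)
      with \<open>N \<subseteq> M\<close> show "\<exists>N\<subseteq>M. \<exists>K. lift a b u N K" by blast
    qed
  qed
  moreover have "start 0 Z u"
    using u w by (simp add: start_def)
  ultimately have "\<exists>N\<subseteq>Z. \<exists>K. lift 0 1 u N K" by simp
  then obtain N K where "lift 0 1 u N K" by blast
  then show ?thesis
    by (intro that[of N K]) (simp_all add: lift_def)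
qed

lemma covering_space_path_lifting:
  fixes X :: "'a::topological_space set"
  assumes cov: "covering_space X \<pi> Y"
    and g: "path g" "path_image g \<subseteq> Y" and x: "x \<in> X" "\<pi> x = pathstart g"
  obtains k where "path k" "path_image k \<subseteq> X" "pathstart k = x"
    "\<And>t. t \<in> {0..1} \<Longrightarrow> \<pi> (k t) = g t"
proof -
  have "continuous_on ({0::real} \<times> {0..1}) (g \<circ> snd)"
    by (intro continuous_on_compose continuous_intros) (use g in \<open>simp add: path_def\<close>)
  moreover have "(g \<circ> snd) ` ({0::real} \<times> {0..1}) \<subseteq> Y"
    using g by (auto simp: path_image_def)
  ultimately obtain N :: "real set" and K where N: "0 \<in> N" and K: "continuous_on (N \<times> {0..1}) K"
    "K ` (N \<times> {0..1}) \<subseteq> X" "\<And>z t. z \<in> N \<Longrightarrow> t \<in> {0..1} \<Longrightarrow> \<pi> (K (z, t)) = (g \<circ> snd) (z, t)"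
    "\<And>z. z \<in> N \<Longrightarrow> K (z, 0) = x"
    by (rule covering_space_lift_path_family[OF cov, where u = "\<lambda>_. x" and Z = "{0::real}" and w = 0])
      (use x in \<open>auto simp: pathstart_def\<close>)
  have "continuous_on {0..1} (\<lambda>t. K (0, t))"
    by (rule continuous_on_compose2[OF K(1)]) (use N in \<open>auto intro!: continuous_intros\<close>)
  then show ?thesis
    using N K(2-4) by (intro that[of "\<lambda>t. K (0, t)"]) (auto simp: path_def path_image_def pathstart_def)
qed

text \<open>
  Lift every stage of the homotopy from the common starting point. The end points of these lifts
  vary continuously with the stage while staying in one fibre, which is discrete; so they are
  locally constant, hence constant.
\<close>

lemma covering_space_homotopic_lifts_finish:
  fixes X :: "'a::topological_space set"
  assumes cov: "covering_space X \<pi> Y" and hom: "homotopic_paths Y f g"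
    and k: "path k" "path_image k \<subseteq> X" "\<And>t. t \<in> {0..1} \<Longrightarrow> \<pi> (k t) = f t"
    and l: "path l" "path_image l \<subseteq> X" "\<And>t. t \<in> {0..1} \<Longrightarrow> \<pi> (l t) = g t"
    and start: "pathstart k = pathstart l"
  shows "pathfinish k = pathfinish l"
proof -
  obtain h where h: "continuous_on ({0..1} \<times> {0..1}) h" "h ` ({0..1} \<times> {0..1}) \<subseteq> Y"
    and h0: "\<And>t. t \<in> {0..1} \<Longrightarrow> h (0, t) = f t" and h1: "\<And>t. t \<in> {0..1} \<Longrightarrow> h (1, t) = g t"
    and hst: "\<And>s. s \<in> {0..1::real} \<Longrightarrow> h (s, 0) = f 0" "\<And>s. s \<in> {0..1::real} \<Longrightarrow> h (s, 1) = f 1"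
    proof -
    from hom obtain h where *: "continuous_on ({0..1} \<times> {0..1}) h" "h \<in> ({0..1} \<times> {0..1}) \<rightarrow> Y"
      "\<forall>t\<in>{0..1}. h (0, t) = f t" "\<forall>t\<in>{0..1}. h (1, t) = g t"
      "\<forall>s\<in>{0..1::real}. pathstart (h \<circ> Pair s) = pathstart f \<and> pathfinish (h \<circ> Pair s) = pathfinish f"
      unfolding homotopic_paths by blast
    show ?thesis
      by (rule that[of h]) (use * in \<open>simp_all add: pathstart_def pathfinish_def image_subset_iff_funcset\<close>)
  qed
  define x where "x = k 0"
  have x: "x \<in> X" "\<pi> x = f 0"
    using k by (auto simp: x_def path_image_def)
  define lifts where "lifts = (\<lambda>s p. path p \<and> path_image p \<subseteq> X \<and> pathstart p = x \<and>
    (\<forall>t\<in>{0..1}. \<pi> (p t) = h (s, t)))"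
  have "\<exists>p. lifts s p" if s: "s \<in> {0..1}" for s
  proof -
    have "continuous_on {0..1} (\<lambda>t. h (s, t))"
      by (rule continuous_on_compose2[OF h(1)]) (use s in \<open>auto intro!: continuous_intros\<close>)
    then have *: "path (\<lambda>t. h (s, t))" "path_image (\<lambda>t. h (s, t)) \<subseteq> Y"
      using h(2) s by (auto simp: path_def path_image_def)
    have "\<pi> x = pathstart (\<lambda>t. h (s, t))"
      using x hst(1)[OF s] by (simp add: pathstart_def)
    then obtain p where "path p" "path_image p \<subseteq> X" "pathstart p = x"
        "\<And>t. t \<in> {0..1} \<Longrightarrow> \<pi> (p t) = h (s, t)"
      by (rule covering_space_path_lifting[OF cov * x(1)]) blast
    then have "lifts s p" by (simp add: lifts_def)
    then show ?thesis by blast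
  qed
  then have "\<forall>s. \<exists>p. s \<in> {0..1} \<longrightarrow> lifts s p" by blast
  from choice[OF this] obtain p where p: "\<And>s. s \<in> {0..1} \<Longrightarrow> lifts s (p s)" by blast
  have unique: "q 1 = p s 1" if "lifts s q" "s \<in> {0..1}" for q s
    by (rule covering_space_path_lifts_eq[OF cov, where k = q and l = "p s" and t = 1]) (use that p[of s] in \<open>auto simp: lifts_def\<close>)
  let ?P = "\<lambda>a b. 0 \<le> a \<and> b \<le> 1 \<longrightarrow> p a 1 = p b 1"
  have "(0::real) \<le> 1" by simp
  then have "?P 0 1"
  proof (induction rule: Bolzano[where P = ?P])
    case (local s)
    then have s: "s \<in> {0..1}" by simp
    obtain N K where N: "openin (top_of_set {0..1}) N" "s \<in> N" and K: "continuous_on (N \<times> {0..1}) K"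
      "K ` (N \<times> {0..1}) \<subseteq> X" "\<And>z t. z \<in> N \<Longrightarrow> t \<in> {0..1} \<Longrightarrow> \<pi> (K (z, t)) = h (z, t)"
      "\<And>z. z \<in> N \<Longrightarrow> K (z, 0) = x"
      by (rule covering_space_lift_path_family[OF cov h, where u = "\<lambda>_. x" and w = s])
        (use s x hst in auto)
    have NI: "N \<subseteq> {0..1}" using openin_imp_subset[OF N(1)] .
    have K1: "K (r, 1) = p r 1" if "r \<in> N" for r
    proof (rule unique)
      have "continuous_on {0..1} (\<lambda>t. K (r, t))"
        by (rule continuous_on_compose2[OF K(1)]) (use that in \<open>auto intro!: continuous_intros\<close>)
      then show "lifts r (\<lambda>t. K (r, t))"
        unfolding lifts_def using that K(2-4) by (auto simp: path_def path_image_def pathstart_def)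
    qed (use that NI in auto)
    have fib: "\<pi> (p r 1) = f 1" "p r 1 \<in> X" if "r \<in> {0..1}" for r
      using p[OF that] hst that by (auto simp: lifts_def path_image_def)
    have "f 1 \<in> Y" using fib[OF s] covering_space_imp_surjective[OF cov] by (metis imageI)
    then obtain V where V: "f 1 \<in> V" and "\<And>x. x \<in> X \<Longrightarrow> \<pi> x \<in> V \<Longrightarrow>
        \<exists>U q. x \<in> U \<and> openin (top_of_set X) U \<and> homeomorphism U V \<pi> q"
      using covering_space_evenly_covered[OF cov] by metis
    then obtain U q where U: "p s 1 \<in> U" "openin (top_of_set X) U" "homeomorphism U V \<pi> q"
      using fib[OF s] by metis
    have "continuous_on N (\<lambda>r. K (r, 1))"
      by (rule continuous_on_compose2[OF K(1)]) (auto intro!: continuous_intros)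
    then have "openin (top_of_set N) (N \<inter> (\<lambda>r. K (r, 1)) -` U)"
      using U K(2) by (intro continuous_openin_preimage[of _ _ X]) auto
    then have "openin (top_of_set {0..1}) (N \<inter> (\<lambda>r. K (r, 1)) -` U)"
      using N(1) openin_trans by blast
    moreover have "s \<in> N \<inter> (\<lambda>r. K (r, 1)) -` U" using N U K1 by auto
    ultimately obtain d where d: "d > 0" "ball s d \<inter> {0..1} \<subseteq> N \<inter> (\<lambda>r. K (r, 1)) -` U"
      by (metis openin_contains_ball)
    have near: "p r 1 = p s 1" if "r \<in> {0..1}" "\<bar>r - s\<bar> < d" for r
    proof -
      have "r \<in> ball s d \<inter> {0..1}"
        using that by (auto simp: dist_real_def abs_minus_commute)
      with d(2) have "r \<in> N" "K (r, 1) \<in> U" by auto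
      then have "p r 1 \<in> U" using K1 by simp
      then show ?thesis
        using U fib[OF s] fib[OF that(1)] by (metis homeomorphism_apply1)
    qed
    show ?case
    proof (intro exI[of _ d] conjI allI impI)
      fix a b assume "a \<le> s \<and> s \<le> b \<and> b - a < d" "0 \<le> a \<and> b \<le> 1"
      then show "p a 1 = p b 1"
        using near[of a] near[of b] by auto
    qed fact
  qed auto
  moreover have "lifts 0 k" "lifts 1 l"
    using k l start h0 h1 by (simp_all add: lifts_def x_def pathstart_def)
  then have "k 1 = p 0 1" "l 1 = p 1 1"
    by (auto intro: unique)
  ultimately show ?thesis by (simp add: pathfinish_def)
qed

section \<open>Homology classes of loops\<close>

text \<open>
  A path and a singular 1-simplex carry the same information; the coordinate \<open>x 1\<close> of the standard
  simplex is the time of the path.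
\<close>

definition path_simplex :: "(real \<Rightarrow> 'a) \<Rightarrow> (nat \<Rightarrow> real) \<Rightarrow> 'a" where
  "path_simplex g = restrict (\<lambda>x. g (x 1)) (standard_simplex 1)"

definition edge_point :: "real \<Rightarrow> nat \<Rightarrow> real" where
  "edge_point t = (\<lambda>i. if i = 0 then 1 - t else if i = 1 then t else 0)"

definition simplex_path :: "((nat \<Rightarrow> real) \<Rightarrow> 'a) \<Rightarrow> real \<Rightarrow> 'a" where
  "simplex_path \<sigma> = \<sigma> \<circ> edge_point"

definition point_simplex :: "'a \<Rightarrow> (nat \<Rightarrow> real) \<Rightarrow> 'a" where
  "point_simplex b = restrict (\<lambda>_. b) (standard_simplex 0)"

lemma edge_point_simps [simp]: "edge_point t 0 = 1 - t" "edge_point t (Suc 0) = t" "edge_point t 2 = 0"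
  by (simp_all add: edge_point_def)

lemma edge_point_in_simplex [simp]: "edge_point t \<in> standard_simplex (Suc 0) \<longleftrightarrow> t \<in> {0..1}"
  by (auto simp: standard_simplex_def edge_point_def)

lemma edge_point_coordinate: "x \<in> standard_simplex (Suc 0) \<Longrightarrow> edge_point (x (Suc 0)) = x"
  by (auto simp: standard_simplex_def edge_point_def fun_eq_iff)

lemma standard_simplex_coordinate: "x \<in> standard_simplex n \<Longrightarrow> x i \<in> {0..1}"
  by (simp add: standard_simplex_def)

lemma continuous_map_edge_point:
  "continuous_map (top_of_set {0..1}) (subtopology (powertop_real UNIV) (standard_simplex 1)) edge_point"
proof -
  have "continuous_on {0..1} (\<lambda>t. edge_point t i)" for i
    unfolding edge_point_def by (cases "i = 0"; cases "i = 1") (auto intro!: continuous_intros)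
  then show ?thesis
    by (simp add: continuous_map_in_subtopology continuous_map_componentwise_UNIV image_subset_iff_funcset[symmetric]
        image_subset_iff)
qed

lemma path_simplex_cong:
  "(\<And>t. t \<in> {0..1} \<Longrightarrow> g t = h t) \<Longrightarrow> path_simplex g = path_simplex h"
  unfolding path_simplex_def using standard_simplex_coordinate by (intro restrict_ext) blast

lemma simplex_path_path_simplex: "t \<in> {0..1} \<Longrightarrow> simplex_path (path_simplex g) t = g t"
  by (simp add: simplex_path_def path_simplex_def)

lemma path_simplex_simplex_path:
  assumes "singular_simplex 1 X \<sigma>"
  shows "path_simplex (simplex_path \<sigma>) = \<sigma>"
proof (rule extensionalityI)
  show "\<sigma> \<in> extensional (standard_simplex 1)"
    using assms by (simp add: singular_simplex_def)
qed (simp_all add: path_simplex_def simplex_path_def edge_point_coordinate)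

lemma singular_simplex_path:
  assumes p: "path p" "path_image p \<subseteq> S"
    and \<phi>: "continuous_map (powertop_real UNIV) euclideanreal \<phi>" "\<phi> ` standard_simplex n \<subseteq> {0..1}"
  shows "singular_simplex n (top_of_set S) (restrict (\<lambda>x. p (\<phi> x)) (standard_simplex n))"
proof -
  have "continuous_map (subtopology (powertop_real UNIV) (standard_simplex n)) (top_of_set {0..1}) \<phi>"
    using \<phi> by (auto simp: continuous_map_in_subtopology continuous_map_from_subtopology)
  moreover have "continuous_map (top_of_set {0..1}) (top_of_set S) p"
    using p by (auto simp: path_def path_image_def)
  ultimately have "continuous_map (subtopology (powertop_real UNIV) (standard_simplex n)) (top_of_set S) (p \<circ> \<phi>)"
    by (rule continuous_map_compose)
  then show ?thesis
    unfolding singular_simplex_def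
    by (auto elim: continuous_map_eq)
qed

lemma singular_simplex_path_simplex:
  "path g \<Longrightarrow> path_image g \<subseteq> S \<Longrightarrow> singular_simplex 1 (top_of_set S) (path_simplex g)"
  unfolding path_simplex_def using standard_simplex_coordinate
  by (intro singular_simplex_path) (auto intro: continuous_map_product_projection)

lemma simplex_path:
  assumes "singular_simplex 1 (top_of_set S) \<sigma>"
  shows "path (simplex_path \<sigma>)" "path_image (simplex_path \<sigma>) \<subseteq> S"
proof -
  have "continuous_map (top_of_set {0..1}) (top_of_set S) (simplex_path \<sigma>)"
    unfolding simplex_path_def
    by (rule continuous_map_compose[OF continuous_map_edge_point])
      (use assms in \<open>simp add: singular_simplex_def\<close>)
  then show "path (simplex_path \<sigma>)" "path_image (simplex_path \<sigma>) \<subseteq> S"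
    by (auto simp: path_def path_image_def)
qed

lemma chain_boundary_1:
  "chain_boundary 1 (frag_of \<sigma>) =
    frag_of (point_simplex (pathfinish (simplex_path \<sigma>))) - frag_of (point_simplex (pathstart (simplex_path \<sigma>)))"
proof -
  have "simplical_face 0 (\<lambda>j. if j = 0 then 1 else 0) = edge_point 1"
    "simplical_face 1 (\<lambda>j. if j = 0 then 1 else 0) = edge_point 0"
    by (auto simp: simplical_face_def edge_point_def)
  then have "singular_face 1 0 \<sigma> = point_simplex (pathfinish (simplex_path \<sigma>))"
    "singular_face 1 1 \<sigma> = point_simplex (pathstart (simplex_path \<sigma>))"
    by (auto simp: singular_face_def point_simplex_def standard_simplex_0 pathfinish_def pathstart_def
        simplex_path_def intro!: restrict_ext)
  then show ?thesis
    by (simp add: chain_boundary_of)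
qed

lemma chain_boundary_path_simplex:
  "chain_boundary 1 (frag_of (path_simplex g)) =
    frag_of (point_simplex (pathfinish g)) - frag_of (point_simplex (pathstart g))"
  by (simp only: chain_boundary_1) (simp add: pathfinish_def pathstart_def simplex_path_path_simplex)

text \<open>
  The singular 2-simplex \<open>x \<mapsto> p (u * x 1 + v * x 2)\<close> factors through the path \<open>p\<close>, and its vertices
  are \<open>p 0\<close>, \<open>p u\<close> and \<open>p v\<close>. Its boundary is the single relation from which the homology of
  concatenated, constant and reversed paths follows, by special choices of \<open>u\<close> and \<open>v\<close>.
\<close>

lemma subpath_triangle_boundary:
  fixes u v :: real
  assumes p: "path p" "path_image p \<subseteq> S" and uv: "u \<in> {0..1}" "v \<in> {0..1}"
  shows "homologous_rel 1 (top_of_set S) {}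
      (frag_of (path_simplex (\<lambda>t. p (v * t))))
      (frag_of (path_simplex (\<lambda>t. p (u * t))) + frag_of (path_simplex (\<lambda>t. p (u + (v - u) * t))))"
proof -
  let ?\<phi> = "\<lambda>x::nat\<Rightarrow>real. u * x 1 + v * x 2"
  let ?\<tau> = "restrict (\<lambda>x. p (?\<phi> x)) (standard_simplex 2)"
  have "?\<phi> x \<in> {0..1}" if "x \<in> standard_simplex 2" for x
  proof -
    have x: "0 \<le> x 0" "0 \<le> x 1" "0 \<le> x 2" "x 0 + x 1 + x 2 = 1"
      using that by (auto simp: standard_simplex_def numeral_2_eq_2)
    have "?\<phi> x \<le> 1 * x 1 + 1 * x 2"
      using x uv by (intro add_mono mult_right_mono) auto
    then show ?thesis using x uv by auto
  qed
  then have "singular_simplex 2 (top_of_set S) ?\<tau>"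
    by (intro singular_simplex_path[OF p])
       (auto intro!: continuous_map_add continuous_map_real_mult continuous_map_product_projection)
  moreover have face: "singular_face 2 k ?\<tau> = restrict (\<lambda>x. p (?\<phi> (simplical_face k x))) (standard_simplex 1)"
    if "k \<le> 2" for k
    using that singular_face_restrict[of 2 k] by (simp add: singular_face_def o_def)
  moreover have "singular_face 2 0 ?\<tau> = path_simplex (\<lambda>t. p (u + (v - u) * t))"
  proof -
    have "?\<phi> (simplical_face 0 x) = u + (v - u) * x 1" if "x \<in> standard_simplex 1" for x
    proof -
      have "x 0 = 1 - x 1" using that by (auto simp: standard_simplex_def)
      then have "u * x 0 = u - u * x 1" by (simp add: right_diff_distrib)
      then show ?thesis by (simp add: simplical_face_def left_diff_distrib)
    qed
    then show ?thesis
      unfolding face[OF le0] path_simplex_def by (intro restrict_ext) simp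
  qed
  moreover have "singular_face 2 1 ?\<tau> = path_simplex (\<lambda>t. p (v * t))"
    by (subst face) (simp_all add: path_simplex_def simplical_face_def)
  moreover have "singular_face 2 2 ?\<tau> = path_simplex (\<lambda>t. p (u * t))"
    by (subst face) (simp_all add: path_simplex_def simplical_face_def)
  ultimately have "singular_relboundary 1 (top_of_set S) {}
     (frag_of (path_simplex (\<lambda>t. p (u + (v - u) * t))) - frag_of (path_simplex (\<lambda>t. p (v * t)))
       + frag_of (path_simplex (\<lambda>t. p (u * t))))"
    unfolding singular_boundary
    by (intro exI[of _ "frag_of ?\<tau>"])
       (simp add: singular_chain_of chain_boundary_of numeral_2_eq_2)
  then have "singular_relboundary 1 (top_of_set S) {}
     (- (frag_of (path_simplex (\<lambda>t. p (u + (v - u) * t))) - frag_of (path_simplex (\<lambda>t. p (v * t)))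
       + frag_of (path_simplex (\<lambda>t. p (u * t)))))"
    by (simp only: singular_relboundary_minus)
  then show ?thesis
    by (simp add: homologous_rel_def algebra_simps)
qed

lemma homologous_join:
  assumes "path g" "path_image g \<subseteq> S" "path h" "path_image h \<subseteq> S" "pathfinish g = pathstart h"
  shows "homologous_rel 1 (top_of_set S) {} (frag_of (path_simplex (g +++ h)))
           (frag_of (path_simplex g) + frag_of (path_simplex h))"
proof -
  have "path_simplex (\<lambda>t. (g +++ h) (1/2 * t)) = path_simplex g"
    by (rule path_simplex_cong) (simp add: joinpaths_def)
  moreover have "(g +++ h) (1/2 + (1 - 1/2) * t) = h t" if "t \<in> {0..1}" for t
    using that assms(5) by (cases "t = 0") (auto simp: joinpaths_def pathfinish_def pathstart_def algebra_simps)
  then have "path_simplex (\<lambda>t. (g +++ h) (1/2 + (1 - 1/2) * t)) = path_simplex h"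
    by (rule path_simplex_cong)
  ultimately show ?thesis
    using subpath_triangle_boundary[of "g +++ h" S "1/2" 1] assms
    by (simp add: subset_path_image_join)
qed

lemma homologous_const:
  assumes "a \<in> S"
  shows "homologous_rel 1 (top_of_set S) {} (frag_of (path_simplex (\<lambda>_. a))) 0"
proof -
  have "homologous_rel 1 (top_of_set S) {} (frag_of (path_simplex (\<lambda>_. a)))
      (frag_of (path_simplex (\<lambda>_. a)) + frag_of (path_simplex (\<lambda>_. a)))"
    \<comment> \<open>all three edges of the triangle are the constant path\<close>
    using subpath_triangle_boundary[of "\<lambda>_. a" S 0 0] assms
    by (simp add: path_def path_image_def image_subset_iff)
  then show ?thesis
    by (simp add: homologous_rel_def) (metis singular_relboundary_minus)
qed

lemma homologous_reverse:
  assumes "path g" "path_image g \<subseteq> S"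
  shows "homologous_rel 1 (top_of_set S) {} (frag_of (path_simplex (reversepath g)))
           (- frag_of (path_simplex g))"
proof -
  have "pathstart g \<in> S"
    using assms by (simp add: pathstart_in_path_image subset_iff)
  then have "homologous_rel 1 (top_of_set S) {} (frag_of (path_simplex (\<lambda>_. g 0))) 0"
    using homologous_const[of "g 0" S] by (simp add: pathstart_def)
  moreover have "homologous_rel 1 (top_of_set S) {} (frag_of (path_simplex (\<lambda>_. g 0)))
     (frag_of (path_simplex g) + frag_of (path_simplex (reversepath g)))"
    \<comment> \<open>the triangle runs along \<open>g\<close> and back, so its third edge is constant\<close>
    using subpath_triangle_boundary[of g S 1 0] assms by (simp add: reversepath_def)
  ultimately have "homologous_rel 1 (top_of_set S) {} (frag_of (path_simplex g) + frag_of (path_simplex (reversepath g))) 0"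
    by (meson homologous_rel_sym homologous_rel_trans)
  then show ?thesis
    by (simp add: homologous_rel_def algebra_simps)
qed

text \<open>
  This is the Hurewicz map, defined on loops rather than on their homotopy classes. It is only
  meaningful on closed paths, where \<^term>\<open>path_simplex g\<close> is a cycle.
\<close>

definition loop_class :: "'a::topological_space set \<Rightarrow> (real \<Rightarrow> 'a) \<Rightarrow> 'a chain set" where
  "loop_class S g = homologous_rel_set 1 (top_of_set S) {} (frag_of (path_simplex g))"

lemma loop_class_cong:
  "(\<And>t. t \<in> {0..1} \<Longrightarrow> g t = h t) \<Longrightarrow> loop_class S g = loop_class S h"
  unfolding loop_class_def using path_simplex_cong by metis

lemma H1_carrier: "carrier (H1 S) = homologous_rel_set 1 (top_of_set S) {} ` singular_relcycle_set 1 (top_of_set S) {}"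
  using carrier_relative_homology_group[of 1 "top_of_set S" "{}"] by simp

lemma H1_mult:
  "homologous_rel_set 1 (top_of_set S) {} c \<otimes>\<^bsub>H1 S\<^esub> homologous_rel_set 1 (top_of_set S) {} d =
    homologous_rel_set 1 (top_of_set S) {} (c + d)"
proof -
  have "\<exists>r s. homologous_rel 1 (top_of_set S) {} c r \<and> homologous_rel 1 (top_of_set S) {} d s \<and> e = r + s"
    if "homologous_rel 1 (top_of_set S) {} (c + d) e" for e
    using that by (intro exI[of _ c] exI[of _ "e - c"])
      (simp add: homologous_rel_def algebra_simps)
  then show ?thesis
    using mult_relative_homology_group[of 1 "top_of_set S" "{}"]
    by (auto simp: homologous_rel_add)
qed

lemma loop_cycle:
  "g \<in> based_loops S a \<Longrightarrow> singular_relcycle 1 (top_of_set S) {} (frag_of (path_simplex g))"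
  using chain_boundary_path_simplex[of g] singular_simplex_path_simplex[of g S]
  by (simp add: singular_cycle singular_chain_of based_loops_def)

lemma loop_class_in_H1: "g \<in> based_loops S a \<Longrightarrow> loop_class S g \<in> carrier (H1 S)"
  unfolding loop_class_def H1_carrier by (intro imageI CollectI loop_cycle)

lemma loop_class_join:
  assumes "g \<in> based_loops S a" "h \<in> based_loops S a"
  shows "loop_class S (g +++ h) = loop_class S g \<otimes>\<^bsub>H1 S\<^esub> loop_class S h"
  unfolding loop_class_def H1_mult homologous_rel_set_eq
  using assms by (intro homologous_join) (auto simp: based_loops_def)

lemma loop_class_eq_one_iff:
  "loop_class S g = \<one>\<^bsub>H1 S\<^esub> \<longleftrightarrow> singular_relboundary 1 (top_of_set S) {} (frag_of (path_simplex g))"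
  using one_relative_homology_group[of 1 "top_of_set S" "{}"]
    homologous_rel_set_eq_relboundary[of 1 "top_of_set S" "{}" "frag_of (path_simplex g)"]
  by (simp add: loop_class_def)

lemma loop_class_reverse:
  assumes "g \<in> based_loops S a"
  shows "loop_class S (reversepath g) = inv\<^bsub>H1 S\<^esub> (loop_class S g)"
proof -
  interpret comm_group "H1 S" by simp
  have "homologous_rel 1 (top_of_set S) {} (frag_of (path_simplex (reversepath g)) + frag_of (path_simplex g))
     (- frag_of (path_simplex g) + frag_of (path_simplex g))"
    using assms by (intro homologous_rel_add homologous_reverse) (auto simp: based_loops_def)
  then have "loop_class S (reversepath g) \<otimes>\<^bsub>H1 S\<^esub> loop_class S g = \<one>\<^bsub>H1 S\<^esub>"
    using one_relative_homology_group[of 1 "top_of_set S" "{}"]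
      homologous_rel_set_eq_relboundary[of 1 "top_of_set S" "{}"]
    unfolding loop_class_def H1_mult by (simp add: homologous_rel_def)
  then show ?thesis
    using assms by (metis inv_equality loop_class_in_H1 based_loops_reverse)
qed

lemma H1_map_loop_class:
  assumes f: "continuous_on S f" "f ` S \<subseteq> T" and g: "g \<in> based_loops S a"
  shows "H1_map S T f (loop_class S g) = loop_class T (f \<circ> g)"
proof -
  have "simplex_map 1 f (path_simplex g) = path_simplex (f \<circ> g)"
    by (auto simp: simplex_map_def path_simplex_def)
  then show ?thesis
    using hom_induced_chain_map[of "top_of_set S" "top_of_set T" f "{}" "{}" 1] loop_cycle[OF g] f
    by (auto simp: loop_class_def image_subset_iff_funcset)
qed

section \<open>The Hurewicz theorem in degree one\<close>

definition spanning_paths :: "'a::topological_space set \<Rightarrow> 'a \<Rightarrow> ('a \<Rightarrow> real \<Rightarrow> 'a) \<Rightarrow> bool" where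
  "spanning_paths S a \<gamma> \<longleftrightarrow>
     (\<forall>b\<in>S. path (\<gamma> b) \<and> path_image (\<gamma> b) \<subseteq> S \<and> pathstart (\<gamma> b) = a \<and> pathfinish (\<gamma> b) = b)"

text \<open>
  With spanning paths \<open>\<gamma>\<close> from a base point, this turns an arbitrary path into a loop at the base
  point; it plays the role that collapsing a spanning tree plays for graphs.
\<close>

definition close_up :: "('a::topological_space \<Rightarrow> real \<Rightarrow> 'a) \<Rightarrow> (real \<Rightarrow> 'a) \<Rightarrow> real \<Rightarrow> 'a" where
  "close_up \<gamma> g = (\<gamma> (pathstart g) +++ g) +++ reversepath (\<gamma> (pathfinish g))"

lemma path_connected_spanning_paths:
  assumes "path_connected S" "a \<in> S"
  obtains \<gamma> where "spanning_paths S a \<gamma>" "\<gamma> a = (\<lambda>_. a)"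
proof -
  have "\<forall>b\<in>S. \<exists>g. path g \<and> path_image g \<subseteq> S \<and> pathstart g = a \<and> pathfinish g = b"
    using assms by (auto simp: path_connected_def)
  then obtain g where "\<And>b. b \<in> S \<Longrightarrow> path (g b) \<and> path_image (g b) \<subseteq> S \<and> pathstart (g b) = a \<and> pathfinish (g b) = b"
    by metis
  then show ?thesis
    using based_loops_const[OF assms(2)]
    by (intro that[of "g(a := \<lambda>_. a)"]) (auto simp: based_loops_def spanning_paths_def)
qed

lemma spanning_pathsD:
  assumes "spanning_paths S a \<gamma>" "b \<in> S"
  shows "path (\<gamma> b)" "path_image (\<gamma> b) \<subseteq> S" "pathstart (\<gamma> b) = a" "pathfinish (\<gamma> b) = b"
  using assms by (simp_all add: spanning_paths_def)

lemma path_ends_in: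
  assumes "path_image g \<subseteq> S" shows "pathstart g \<in> S" "pathfinish g \<in> S"
  using assms by (auto simp: pathstart_in_path_image pathfinish_in_path_image subset_iff)

lemma close_up_loop:
  assumes \<gamma>: "spanning_paths S a \<gamma>" and g: "path g" "path_image g \<subseteq> S"
  shows "close_up \<gamma> g \<in> based_loops S a"
  using spanning_pathsD[OF \<gamma> path_ends_in(1)[OF g(2)]] spanning_pathsD[OF \<gamma> path_ends_in(2)[OF g(2)]] g
  by (simp add: based_loops_def close_up_def subset_path_image_join)

lemma homologous_close_up:
  assumes \<gamma>: "spanning_paths S a \<gamma>" and g: "path g" "path_image g \<subseteq> S"
  shows "homologous_rel 1 (top_of_set S) {} (frag_of (path_simplex (close_up \<gamma> g)))
    (frag_of (path_simplex g) - (frag_of (path_simplex (\<gamma> (pathfinish g))) - frag_of (path_simplex (\<gamma> (pathstart g)))))"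
proof -
  note s = spanning_pathsD[OF \<gamma> path_ends_in(1)[OF g(2)]]
  note f = spanning_pathsD[OF \<gamma> path_ends_in(2)[OF g(2)]]
  let ?h = "homologous_rel 1 (top_of_set S) {}"
  have "?h (frag_of (path_simplex (close_up \<gamma> g)))
      (frag_of (path_simplex (\<gamma> (pathstart g) +++ g)) + frag_of (path_simplex (reversepath (\<gamma> (pathfinish g)))))"
    unfolding close_up_def using s f g by (intro homologous_join) (auto simp: subset_path_image_join)
  moreover have "?h (frag_of (path_simplex (\<gamma> (pathstart g) +++ g)) + frag_of (path_simplex (reversepath (\<gamma> (pathfinish g)))))
      ((frag_of (path_simplex (\<gamma> (pathstart g))) + frag_of (path_simplex g)) + - frag_of (path_simplex (\<gamma> (pathfinish g))))"
    using s f g by (intro homologous_rel_add homologous_join homologous_reverse) auto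
  ultimately have "?h (frag_of (path_simplex (close_up \<gamma> g)))
      ((frag_of (path_simplex (\<gamma> (pathstart g))) + frag_of (path_simplex g)) + - frag_of (path_simplex (\<gamma> (pathfinish g))))"
    by (rule homologous_rel_trans[rotated])
  then show ?thesis
    by (simp add: algebra_simps)
qed

text \<open>
  The homomorphism \<open>\<Gamma>\<close> sends a 0-simplex to the spanning path of its value at the vertex of the
  standard simplex, so that a 1-simplex minus \<open>\<Gamma>\<close> of its
  boundary is homologous to the simplex closed up to a loop. Both sides are additive, which extends
  this to all chains; on cycles the correction term vanishes. Stating it for chains rather than
  cycles is what makes induction on the chain possible.
\<close>

lemma singular_1_chain_homologous_loop:
  assumes \<gamma>: "spanning_paths S a \<gamma>" and a: "a \<in> S"
    and c: "singular_chain 1 (top_of_set S) c"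
  defines "\<Gamma> \<equiv> frag_extend (\<lambda>\<nu>. frag_of (path_simplex (\<gamma> (\<nu> (\<lambda>j. if j = 0 then 1 else 0)))))"
  shows "\<exists>g\<in>based_loops S a. homologous_rel 1 (top_of_set S) {} (c - \<Gamma> (chain_boundary 1 c)) (frag_of (path_simplex g))"
  using c unfolding singular_chain_def
proof (induction rule: frag_induction)
  case zero
  show ?case
    using based_loops_const[OF a] homologous_rel_sym[of 1 "top_of_set S" "{}"] homologous_const[OF a]
    by (intro bexI[of _ "\<lambda>_. a"]) (auto simp: \<Gamma>_def)
next
  case (one \<sigma>)
  then have \<sigma>: "singular_simplex 1 (top_of_set S) \<sigma>" by simp
  let ?p = "simplex_path \<sigma>"
  have \<Gamma>: "\<Gamma> (frag_of (point_simplex b)) = frag_of (path_simplex (\<gamma> b))" for b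
    by (simp add: \<Gamma>_def point_simplex_def standard_simplex_0)
  have "\<Gamma> (chain_boundary 1 (frag_of \<sigma>)) =
      frag_of (path_simplex (\<gamma> (pathfinish ?p))) - frag_of (path_simplex (\<gamma> (pathstart ?p)))"
    unfolding chain_boundary_1 \<Gamma>[symmetric] by (simp add: \<Gamma>_def frag_extend_diff)
  then show ?case
    using homologous_close_up[OF \<gamma> simplex_path[OF \<sigma>]] close_up_loop[OF \<gamma> simplex_path[OF \<sigma>]]
    by (metis homologous_rel_sym path_simplex_simplex_path[OF \<sigma>])
next
  case (diff c d)
  then obtain g h where g: "g \<in> based_loops S a" and h: "h \<in> based_loops S a"
    and gc: "homologous_rel 1 (top_of_set S) {} (c - \<Gamma> (chain_boundary 1 c)) (frag_of (path_simplex g))"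
    and hd: "homologous_rel 1 (top_of_set S) {} (d - \<Gamma> (chain_boundary 1 d)) (frag_of (path_simplex h))"
    by blast
  let ?h = "homologous_rel 1 (top_of_set S) {}"
  have join: "?h (frag_of (path_simplex (g +++ reversepath h)))
      (frag_of (path_simplex g) + frag_of (path_simplex (reversepath h)))"
    using g h by (intro homologous_join) (auto simp: based_loops_def)
  have "?h (frag_of (path_simplex g) + frag_of (path_simplex (reversepath h)))
      (frag_of (path_simplex g) + - frag_of (path_simplex h))"
    using h by (intro homologous_rel_add homologous_reverse) (auto simp: based_loops_def)
  from homologous_rel_trans[OF this join]
  have "?h (frag_of (path_simplex g) - frag_of (path_simplex h)) (frag_of (path_simplex (g +++ reversepath h)))"
    by (subst homologous_rel_sym) simp
  from homologous_rel_trans[OF this homologous_rel_diff[OF gc hd]]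
  have "?h ((c - \<Gamma> (chain_boundary 1 c)) - (d - \<Gamma> (chain_boundary 1 d)))
      (frag_of (path_simplex (g +++ reversepath h)))" .
  moreover have "(c - \<Gamma> (chain_boundary 1 c)) - (d - \<Gamma> (chain_boundary 1 d)) =
      (c - d) - \<Gamma> (chain_boundary 1 (c - d))"
    by (simp add: \<Gamma>_def chain_boundary_diff frag_extend_diff)
  ultimately have "?h ((c - d) - \<Gamma> (chain_boundary 1 (c - d))) (frag_of (path_simplex (g +++ reversepath h)))"
    by (simp only:)
  then show ?case
    using based_loops_join[OF g based_loops_reverse[OF h]] by blast
qed

theorem hurewicz_surjective:
  assumes S: "path_connected S" and a: "a \<in> S"
  shows "carrier (H1 S) = loop_class S ` based_loops S a"
proof
  show "loop_class S ` based_loops S a \<subseteq> carrier (H1 S)"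
    by (auto simp: loop_class_in_H1)
  obtain \<gamma> where \<gamma>: "spanning_paths S a \<gamma>"
    by (rule path_connected_spanning_paths[OF assms])
  show "carrier (H1 S) \<subseteq> loop_class S ` based_loops S a"
  proof
    fix z assume "z \<in> carrier (H1 S)"
    then obtain c where z: "z = homologous_rel_set 1 (top_of_set S) {} c"
      and "singular_relcycle 1 (top_of_set S) {} c"
      unfolding H1_carrier by blast
    then have c: "singular_chain 1 (top_of_set S) c" "chain_boundary 1 c = 0"
      by (simp_all add: singular_cycle)
    obtain g where "g \<in> based_loops S a" "homologous_rel 1 (top_of_set S) {} c (frag_of (path_simplex g))"
      using singular_1_chain_homologous_loop[OF \<gamma> a c(1)] unfolding c(2) by auto
    then have "z = loop_class S g"
      unfolding z loop_class_def homologous_rel_set_eq by simp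
    with \<open>g \<in> based_loops S a\<close> show "z \<in> loop_class S ` based_loops S a" by blast
  qed
qed

text \<open>
  In the plane triangle with vertices \<open>(0,0)\<close>, \<open>(1,0)\<close>, \<open>(0,1)\<close>, which parametrises the standard
  2-simplex, the two ways along the edges are homotopic by convexity; the simplex maps this homotopy
  into \<open>S\<close>.
\<close>

lemma singular_2_simplex_edges_homotopic:
  assumes \<tau>: "singular_simplex 2 (top_of_set S) \<tau>"
  shows "homotopic_paths S (simplex_path (singular_face 2 2 \<tau>) +++ simplex_path (singular_face 2 0 \<tau>))
    (simplex_path (singular_face 2 1 \<tau>))"
proof -
  define D where "D = {z::real \<times> real. 0 \<le> fst z \<and> 0 \<le> snd z \<and> fst z + snd z \<le> 1}"
  define e :: "real \<times> real \<Rightarrow> nat \<Rightarrow> real" where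
    "e z = (\<lambda>i. if i = 0 then 1 - fst z - snd z else if i = 1 then fst z else if i = 2 then snd z else 0)" for z
  have "convex D"
  proof (rule convexI)
    fix x y u v assume "x \<in> D" "y \<in> D" "0 \<le> u" "0 \<le> v" "u + v = (1::real)"
    then have "u * (fst x + snd x) + v * (fst y + snd y) \<le> 1"
      by (intro convex_bound_le) (auto simp: D_def)
    with \<open>x \<in> D\<close> \<open>y \<in> D\<close> \<open>0 \<le> u\<close> \<open>0 \<le> v\<close> show "u *\<^sub>R x + v *\<^sub>R y \<in> D"
      by (simp add: D_def algebra_simps)
  qed
  have "continuous_on D (\<lambda>z. e z i)" for i
    unfolding e_def by (cases "i = 0"; cases "i = 1"; cases "i = 2") (auto intro!: continuous_intros)
  moreover have "e z \<in> standard_simplex 2" if "z \<in> D" for z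
    using that by (auto simp: standard_simplex_def numeral_2_eq_2 D_def e_def)
  ultimately have "continuous_map (top_of_set D) (subtopology (powertop_real UNIV) (standard_simplex 2)) e"
    by (auto simp: continuous_map_in_subtopology continuous_map_componentwise_UNIV)
  moreover have "continuous_map (subtopology (powertop_real UNIV) (standard_simplex 2)) (top_of_set S) \<tau>"
    using \<tau> by (simp add: singular_simplex_def)
  ultimately have "continuous_map (top_of_set D) (top_of_set S) (\<tau> \<circ> e)"
    by (rule continuous_map_compose)
  then have F: "continuous_on D (\<tau> \<circ> e)" "\<tau> \<circ> e \<in> D \<rightarrow> S"
    by auto
  let ?l01 = "linepath (0,0) (1,0::real) :: real \<Rightarrow> real \<times> real"
  let ?l12 = "linepath (1,0) (0,1::real) :: real \<Rightarrow> real \<times> real"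
  let ?l02 = "linepath (0,0) (0,1::real) :: real \<Rightarrow> real \<times> real"
  have "(0,0) \<in> D" "(1,0) \<in> D" "(0,1) \<in> D"
    by (simp_all add: D_def)
  then have in_D: "path_image (?l01 +++ ?l12) \<subseteq> D" "path_image ?l02 \<subseteq> D"
    using \<open>convex D\<close> by (simp_all add: closed_segment_subset subset_path_image_join)
  have "homotopic_paths D (?l01 +++ ?l12) ?l02"
  proof (rule homotopic_paths_linear)
    show "closed_segment ((?l01 +++ ?l12) t) (?l02 t) \<subseteq> D" if "t \<in> {0..1}" for t
      using in_D that by (intro closed_segment_subset \<open>convex D\<close>) (auto simp: path_image_def image_subset_iff)
  qed auto
  then have "homotopic_paths S ((\<tau> \<circ> e) \<circ> (?l01 +++ ?l12)) ((\<tau> \<circ> e) \<circ> ?l02)"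
    using F by (rule homotopic_paths_continuous_image)
  then have *: "homotopic_paths S (((\<tau> \<circ> e) \<circ> ?l01) +++ ((\<tau> \<circ> e) \<circ> ?l12)) ((\<tau> \<circ> e) \<circ> ?l02)"
    by (simp add: path_compose_join)
  have edges: "((\<tau> \<circ> e) \<circ> ?l01) t = simplex_path (singular_face 2 2 \<tau>) t"
    "((\<tau> \<circ> e) \<circ> ?l12) t = simplex_path (singular_face 2 0 \<tau>) t"
    "((\<tau> \<circ> e) \<circ> ?l02) t = simplex_path (singular_face 2 1 \<tau>) t" if "t \<in> {0..1}" for t
  proof -
    have "e (?l01 t) = simplical_face 2 (edge_point t)" "e (?l12 t) = simplical_face 0 (edge_point t)"
      "e (?l02 t) = simplical_face 1 (edge_point t)"
      by (auto simp: e_def simplical_face_def edge_point_def linepath_def fun_eq_iff)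
    then show "((\<tau> \<circ> e) \<circ> ?l01) t = simplex_path (singular_face 2 2 \<tau>) t"
      "((\<tau> \<circ> e) \<circ> ?l12) t = simplex_path (singular_face 2 0 \<tau>) t"
      "((\<tau> \<circ> e) \<circ> ?l02) t = simplex_path (singular_face 2 1 \<tau>) t"
      using that by (simp_all add: simplex_path_def singular_face_def)
  qed
  note hp = homotopic_paths_imp_path[OF *] homotopic_paths_imp_subset[OF *]
  have "homotopic_paths S (((\<tau> \<circ> e) \<circ> ?l01) +++ ((\<tau> \<circ> e) \<circ> ?l12))
     (simplex_path (singular_face 2 2 \<tau>) +++ simplex_path (singular_face 2 0 \<tau>))"
  proof (rule homotopic_paths_eq[OF hp(1)[THEN conjunct1] hp(2)[THEN conjunct1]])
    show "(((\<tau> \<circ> e) \<circ> ?l01) +++ ((\<tau> \<circ> e) \<circ> ?l12)) t =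
        (simplex_path (singular_face 2 2 \<tau>) +++ simplex_path (singular_face 2 0 \<tau>)) t" if "t \<in> {0..1}" for t
      using that edges(1)[of "2 * t"] edges(2)[of "2 * t - 1"] by (simp add: joinpaths_def)
  qed
  moreover have "homotopic_paths S ((\<tau> \<circ> e) \<circ> ?l02) (simplex_path (singular_face 2 1 \<tau>))"
    by (rule homotopic_paths_eq[OF hp(1)[THEN conjunct2] hp(2)[THEN conjunct2]]) (rule edges(3))
  ultimately show ?thesis
    using * by (meson homotopic_paths_sym homotopic_paths_trans)
qed

lemma homotopic_paths_cancel:
  assumes p: "path p" "path_image p \<subseteq> S" and c: "path c" "path_image c \<subseteq> S" and q: "path q" "path_image q \<subseteq> S"
    and "pathfinish p = pathfinish c" "pathfinish c = pathstart q"
  shows "homotopic_paths S ((p +++ reversepath c) +++ (c +++ q)) (p +++ q)"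
proof -
  have "homotopic_paths S ((p +++ reversepath c) +++ (c +++ q)) (((p +++ reversepath c) +++ c) +++ q)"
    using assms by (intro homotopic_paths_assoc) (auto simp: subset_path_image_join)
  moreover have "homotopic_paths S (((p +++ reversepath c) +++ c) +++ q) (p +++ q)"
  proof (rule homotopic_paths_join)
    have "homotopic_paths S ((p +++ reversepath c) +++ c) (p +++ (reversepath c +++ c))"
      using assms by (intro homotopic_paths_sym[OF homotopic_paths_assoc]) auto
    moreover have "homotopic_paths S (reversepath c +++ reversepath (reversepath c)) (\<lambda>_. pathfinish c)"
      using c by (intro homotopic_paths_reverse_right) auto
    then have "homotopic_paths S (p +++ (reversepath c +++ c)) (p +++ (\<lambda>_. pathfinish c))"
      using assms by (intro homotopic_paths_join) auto
    moreover have "homotopic_paths S (p +++ (\<lambda>_. pathfinish c)) p"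
      using assms by (intro homotopic_paths_const_right) auto
    ultimately show "homotopic_paths S ((p +++ reversepath c) +++ c) p"
      by (meson homotopic_paths_trans)
  qed (use assms in auto)
  ultimately show ?thesis by (rule homotopic_paths_trans)
qed

lemma path_class_eqI: "homotopic_paths S g h \<Longrightarrow> path_class S g = path_class S h"
  using path_class_eq_iff homotopic_paths_imp_path homotopic_paths_imp_subset by metis

text \<open>
  The return along \<open>\<gamma>\<close> at the end of the first loop cancels the start of the second one. Thus closing
  up turns composition of paths into the product of the fundamental group.
\<close>

lemma close_up_join:
  assumes \<gamma>: "spanning_paths S a \<gamma>" and g: "path g" "path_image g \<subseteq> S" and h: "path h" "path_image h \<subseteq> S"
    and gh: "pathfinish g = pathstart h" and k: "homotopic_paths S (g +++ h) k"
  shows "path_class S (close_up \<gamma> g) \<otimes>\<^bsub>fundamental_group S a\<^esub> path_class S (close_up \<gamma> h) =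
     path_class S (close_up \<gamma> k)"
proof -
  let ?s = "\<gamma> (pathstart g)" and ?m = "\<gamma> (pathfinish g)" and ?f = "\<gamma> (pathfinish h)"
  note s = spanning_pathsD[OF \<gamma> path_ends_in(1)[OF g(2)]]
  note m = spanning_pathsD[OF \<gamma> path_ends_in(2)[OF g(2)]]
  note f = spanning_pathsD[OF \<gamma> path_ends_in(2)[OF h(2)]]
  have ends: "pathstart k = pathstart g" "pathfinish k = pathfinish h"
    using homotopic_paths_imp_pathstart[OF k] homotopic_paths_imp_pathfinish[OF k] by simp_all
  have "homotopic_paths S ((?m +++ h) +++ reversepath ?f) (?m +++ (h +++ reversepath ?f))"
    by (rule homotopic_paths_sym[OF homotopic_paths_assoc]) (use m f h gh in auto)
  then have "homotopic_paths S (close_up \<gamma> g +++ close_up \<gamma> h)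
     (((?s +++ g) +++ reversepath ?m) +++ (?m +++ (h +++ reversepath ?f)))"
    unfolding close_up_def gh[symmetric]
    by (rule homotopic_paths_join[rotated]) (use s m g in \<open>auto simp: subset_path_image_join\<close>)
  moreover have "homotopic_paths S (((?s +++ g) +++ reversepath ?m) +++ (?m +++ (h +++ reversepath ?f)))
     ((?s +++ g) +++ (h +++ reversepath ?f))"
    by (rule homotopic_paths_cancel) (use s m f g h gh in \<open>auto simp: subset_path_image_join\<close>)
  moreover have "homotopic_paths S ((?s +++ g) +++ (h +++ reversepath ?f)) (((?s +++ g) +++ h) +++ reversepath ?f)"
    by (rule homotopic_paths_assoc) (use s m f g h gh in \<open>auto simp: subset_path_image_join\<close>)
  moreover have "homotopic_paths S ((?s +++ g) +++ h) (?s +++ (g +++ h))"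
    by (rule homotopic_paths_sym[OF homotopic_paths_assoc]) (use s g h gh in auto)
  then have "homotopic_paths S (((?s +++ g) +++ h) +++ reversepath ?f) ((?s +++ (g +++ h)) +++ reversepath ?f)"
    by (rule homotopic_paths_join) (use f in auto)
  moreover have "homotopic_paths S (?s +++ (g +++ h)) (?s +++ k)"
    by (rule homotopic_paths_join[OF _ k]) (use s in auto)
  then have "homotopic_paths S ((?s +++ (g +++ h)) +++ reversepath ?f) (close_up \<gamma> k)"
    unfolding close_up_def ends by (rule homotopic_paths_join) (use f in auto)
  ultimately have "homotopic_paths S (close_up \<gamma> g +++ close_up \<gamma> h) (close_up \<gamma> k)"
    by (meson homotopic_paths_trans)
  then show ?thesis
    using close_up_loop[OF \<gamma> g] close_up_loop[OF \<gamma> h] by (simp add: fundamental_group_mult path_class_eqI)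
qed

text \<open>
  Closing up simplices and passing to the abelianised fundamental group extends to a homomorphism
  \<open>\<phi>\<close> on the free abelian group of 1-chains. It kills the boundary of every 2-simplex, since the
  edges of the simplex bound a homotopy; hence it kills every boundary. On a loop \<open>\<phi>\<close> is the class
  of the loop itself, which therefore is trivial in the abelianisation if the loop is a boundary.
\<close>

theorem hurewicz_kernel:
  assumes S: "path_connected S" and g: "g \<in> based_loops S a"
    and null: "loop_class S g = \<one>\<^bsub>H1 S\<^esub>"
  shows "path_class S g \<in> derived (fundamental_group S a) (carrier (fundamental_group S a))"
proof -
  let ?G = "fundamental_group S a" and ?X = "top_of_set S"
  let ?D = "derived ?G (carrier ?G)"
  have a: "a \<in> S" using g path_ends_in(1)[of g S] by (auto simp: based_loops_def)
  interpret G: group ?G using a by (rule group_fundamental_group)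
  interpret D: normal ?D ?G by (rule G.derived_self_is_normal)
  interpret Q: comm_group "?G Mod ?D" by (rule G.derived_quot_is_comm_group)
  obtain \<gamma> where \<gamma>: "spanning_paths S a \<gamma>" and \<gamma>a: "\<gamma> a = (\<lambda>_. a)"
    by (rule path_connected_spanning_paths[OF S a])
  define cls where "cls \<sigma> = path_class S (close_up \<gamma> (simplex_path \<sigma>))" for \<sigma>
  have cls: "cls \<sigma> \<in> carrier ?G" if "singular_simplex 1 ?X \<sigma>" for \<sigma>
    using close_up_loop[OF \<gamma> simplex_path[OF that]] by (simp add: cls_def fundamental_group_def)
  \<comment> \<open>keep the quotient opaque, so that rewriting does not descend to products of cosets\<close>
  note mult_FactGroup [simp del] one_FactGroup [simp del]
  let ?q = "\<lambda>x. ?D #>\<^bsub>?G\<^esub> x"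
  have q: "?q \<in> hom ?G (?G Mod ?D)" by (rule D.r_coset_hom_Mod)
  have "(?q \<circ> cls) ` singular_simplex_set 1 ?X \<subseteq> carrier (?G Mod ?D)"
    using cls hom_in_carrier[OF q] by auto
  then obtain \<phi> where \<phi>: "\<phi> \<in> hom (free_Abelian_group (singular_simplex_set 1 ?X)) (?G Mod ?D)"
    and \<phi>_of: "\<And>\<sigma>. singular_simplex 1 ?X \<sigma> \<Longrightarrow> \<phi> (frag_of \<sigma>) = ?q (cls \<sigma>)"
    by (rule Q.free_Abelian_group_universal) auto
  then have "\<phi> \<in> hom (chain_group 1 ?X) (?G Mod ?D)" by (simp add: chain_group_def)
  then interpret \<phi>: group_hom "chain_group 1 ?X" "?G Mod ?D" \<phi>
    by (simp add: group_hom_def group_hom_axioms_def)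
  have add: "\<phi> (c + d) = \<phi> c \<otimes>\<^bsub>?G Mod ?D\<^esub> \<phi> d"
    if "singular_chain 1 ?X c" "singular_chain 1 ?X d" for c d
    using \<phi>.hom_mult[of c d] that by simp
  have triangle: "\<phi> (chain_boundary 2 (frag_of \<tau>)) = \<one>\<^bsub>?G Mod ?D\<^esub>" if \<tau>: "singular_simplex 2 ?X \<tau>" for \<tau>
  proof -
    have face: "singular_simplex 1 ?X (singular_face 2 k \<tau>)" if "k \<le> 2" for k
      using singular_simplex_singular_face[OF \<tau> _ that] by simp
    note hom = singular_2_simplex_edges_homotopic[OF \<tau>]
    have "cls (singular_face 2 2 \<tau>) \<otimes>\<^bsub>?G\<^esub> cls (singular_face 2 0 \<tau>) = cls (singular_face 2 1 \<tau>)"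
      unfolding cls_def
    proof (rule close_up_join[OF \<gamma> _ _ _ _ _ hom])
      have "simplical_face 2 (edge_point 1) = simplical_face 0 (edge_point 0)"
        by (auto simp: simplical_face_def edge_point_def fun_eq_iff)
      then show "pathfinish (simplex_path (singular_face 2 2 \<tau>)) = pathstart (simplex_path (singular_face 2 0 \<tau>))"
        by (simp add: pathfinish_def pathstart_def simplex_path_def singular_face_def)
    qed (use simplex_path[OF face] in auto)
    then have "\<phi> (frag_of (singular_face 2 2 \<tau>)) \<otimes>\<^bsub>?G Mod ?D\<^esub> \<phi> (frag_of (singular_face 2 0 \<tau>)) =
        \<phi> (frag_of (singular_face 2 1 \<tau>))"
      using face by (simp add: \<phi>_of cls flip: hom_mult[OF q])
    then have eq: "\<phi> (frag_of (singular_face 2 2 \<tau>) + frag_of (singular_face 2 0 \<tau>)) =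
        \<phi> (frag_of (singular_face 2 1 \<tau>))"
      using face by (simp add: add singular_chain_of)
    have "chain_boundary 2 (frag_of \<tau>) =
       (frag_of (singular_face 2 2 \<tau>) + frag_of (singular_face 2 0 \<tau>)) + - frag_of (singular_face 2 1 \<tau>)"
      by (simp add: chain_boundary_of numeral_2_eq_2)
    also have "\<phi> \<dots> = \<phi> (frag_of (singular_face 2 1 \<tau>)) \<otimes>\<^bsub>?G Mod ?D\<^esub> \<phi> (- frag_of (singular_face 2 1 \<tau>))"
      using face eq by (subst add) (simp_all add: singular_chain_of singular_chain_add singular_chain_minus)
    also have "\<dots> = \<phi> 0"
      using face by (subst add[symmetric]) (simp_all add: singular_chain_of singular_chain_minus)
    also have "\<dots> = \<one>\<^bsub>?G Mod ?D\<^esub>" using \<phi>.hom_one by simp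
    finally show ?thesis .
  qed
  have boundary: "\<phi> (chain_boundary 2 d) = \<one>\<^bsub>?G Mod ?D\<^esub>" if "singular_chain 2 ?X d" for d
  proof -
    have "singular_chain 2 ?X d \<and> \<phi> (chain_boundary 2 d) = \<one>\<^bsub>?G Mod ?D\<^esub>"
      using that[unfolded singular_chain_def]
    proof (induction rule: frag_induction)
      case (diff c d)
      then have "singular_chain 1 ?X (chain_boundary 2 c)" "singular_chain 1 ?X (chain_boundary 2 d)"
        using singular_chain_boundary[of 2] by fastforce+
      then have "\<phi> (chain_boundary 2 (c - d)) \<otimes>\<^bsub>?G Mod ?D\<^esub> \<phi> (chain_boundary 2 d) = \<phi> (chain_boundary 2 c)"
        by (subst add[symmetric]) (simp_all add: chain_boundary_diff singular_chain_diff)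
      moreover have "\<phi> (chain_boundary 2 (c - d)) \<in> carrier (?G Mod ?D)"
        using \<open>singular_chain 1 ?X (chain_boundary 2 c)\<close> \<open>singular_chain 1 ?X (chain_boundary 2 d)\<close>
        by (intro \<phi>.hom_closed) (simp add: chain_boundary_diff singular_chain_diff)
      ultimately show ?case
        using diff by (simp add: singular_chain_diff)
    qed (use \<phi>.hom_one triangle in \<open>simp_all add: singular_chain_of\<close>)
    then show ?thesis ..
  qed
  have "\<phi> (frag_of (path_simplex g)) = \<one>\<^bsub>?G Mod ?D\<^esub>"
  proof -
    obtain d where "singular_chain 2 ?X d" "chain_boundary 2 d = frag_of (path_simplex g)"
      using null unfolding loop_class_eq_one_iff singular_boundary by (auto simp: numeral_2_eq_2)
    then show ?thesis using boundary by metis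
  qed
  moreover have "\<phi> (frag_of (path_simplex g)) = ?q (path_class S g)"
  proof -
    have gS: "path g" "path_image g \<subseteq> S" "pathstart g = a" "pathfinish g = a"
      using g by (auto simp: based_loops_def)
    let ?c = "\<lambda>_::real. a"
    have c: "path ?c" "path_image ?c \<subseteq> S" "pathstart ?c = a" "pathfinish ?c = a" "reversepath ?c = ?c"
      using based_loops_const[OF a] by (auto simp: based_loops_def reversepath_def)
    \<comment> \<open>as \<open>\<gamma> a\<close> is constant, closing up a loop at \<open>a\<close> does not change its class\<close>
    let ?g = "simplex_path (path_simplex g)"
    have ends: "pathstart ?g = a" "pathfinish ?g = a"
      using gS by (simp_all add: pathstart_def pathfinish_def simplex_path_path_simplex)
    have "homotopic_paths S g ?g"
      using gS by (intro homotopic_paths_eq) (simp_all add: simplex_path_path_simplex)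
    then have "homotopic_paths S (?c +++ g) (?c +++ ?g)"
      by (rule homotopic_paths_join[rotated]) (use gS c in auto)
    moreover have "path (?c +++ ?g)" "path_image (?c +++ ?g) \<subseteq> S" "pathfinish (?c +++ ?g) = a"
      using homotopic_paths_imp_path[OF calculation] homotopic_paths_imp_subset[OF calculation] ends
      by simp_all
    then have "homotopic_paths S (close_up \<gamma> ?g) (?c +++ ?g)"
      unfolding close_up_def ends \<gamma>a c(5) by (rule homotopic_paths_const_right)
    moreover have "homotopic_paths S (?c +++ g) g"
      using gS by (intro homotopic_paths_const_left) auto
    ultimately have "cls (path_simplex g) = path_class S g"
      unfolding cls_def by (metis path_class_eqI)
    then show ?thesis
      using \<phi>_of[OF singular_simplex_path_simplex] gS by simp
  qed
  moreover have "path_class S g \<in> carrier ?G"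
    using g by (simp add: fundamental_group_def)
  ultimately show ?thesis
    using G.rcos_self[OF _ D.subgroup_axioms, of "path_class S g"] by (simp add: one_FactGroup)
qed

section \<open>Path-connected preimages under inductive coverings\<close>

lemma path_compose_continuous:
  assumes "continuous_on S f" "f ` S \<subseteq> T" "path g" "path_image g \<subseteq> S"
  shows "path (f \<circ> g)" "path_image (f \<circ> g) \<subseteq> T"
  using assms continuous_on_subset[of S f "path_image g"]
  by (auto simp: path_image_compose intro: path_continuous_image)

lemma based_loops_image:
  assumes "continuous_on S f" "f ` S \<subseteq> T" "g \<in> based_loops S a"
  shows "f \<circ> g \<in> based_loops T (f a)"
  using assms path_compose_continuous[OF assms(1,2)]
  by (simp add: based_loops_def pathstart_compose pathfinish_compose)

text \<open>
  The commutator subgroup of \<open>\<pi>\<^sub>1(Y)\<close> consists of images of loops in \<open>X\<close>, so the given loop is homotopic to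
  such an image, whose lift is closed; homotopic loops have lifts with the same end point.
\<close>

lemma inductive_covering_derived_loop_lifts:
  fixes X :: "'a::topological_space set"
  assumes cov: "covering_space X \<pi> Y" and x: "x \<in> X"
    and iso: "pi1_map Y \<pi> \<in> iso (commutator_subgroup (fundamental_group X x))
                              (commutator_subgroup (fundamental_group Y (\<pi> x)))"
    and g: "g \<in> based_loops Y (\<pi> x)"
    and derived: "path_class Y g \<in> derived (fundamental_group Y (\<pi> x)) (carrier (fundamental_group Y (\<pi> x)))"
    and k: "path k" "path_image k \<subseteq> X" "pathstart k = x" "\<And>t. t \<in> {0..1} \<Longrightarrow> \<pi> (k t) = g t"
  shows "pathfinish k = x"
proof -
  interpret G: group "fundamental_group X x" using x by (rule group_fundamental_group)
  have c: "continuous_on X \<pi>" "\<pi> ` X \<subseteq> Y"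
    using cov by (auto simp: covering_space_def)
  have "path_class Y g \<in> pi1_map Y \<pi> ` carrier (commutator_subgroup (fundamental_group X x))"
    using iso derived by (auto simp: iso_def bij_betw_def commutator_subgroup_def)
  then obtain A where A: "A \<in> carrier (fundamental_group X x)" and eq: "path_class Y g = pi1_map Y \<pi> A"
    using G.derived_in_carrier[of "carrier (fundamental_group X x)"] by (auto simp: commutator_subgroup_def)
  then obtain l where l: "l \<in> based_loops X x" "A = path_class X l"
    by (auto simp: fundamental_group_def)
  have "path_class Y g = path_class Y (\<pi> \<circ> l)"
    using eq l pi1_map_class[OF c] by simp
  then have "homotopic_paths Y g (\<pi> \<circ> l)"
    using g path_class_eq_iff by (auto simp: based_loops_def)
  then have "pathfinish k = pathfinish l"
    by (rule covering_space_homotopic_lifts_finish[OF cov _ k(1,2,4)]) (use l k in \<open>auto simp: based_loops_def\<close>)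
  then show ?thesis using l by (simp add: based_loops_def)
qed

text \<open>
  The condition on commutator subgroups is given at one point \<open>x\<close> only, while the lift may start
  anywhere. Conjugating with a path \<open>d\<close> from \<open>x\<close> moves the loop to that base point without changing its
  homology class. The lift of the conjugated loop then closes up, and uniqueness of lifts, applied
  to the returning piece, shows that it returns along \<open>d\<close> itself.
\<close>

lemma inductive_covering_null_homologous_loop_lifts:
  fixes X :: "'a::topological_space set"
  assumes ind: "inductive_covering X \<pi> Y"
    and g: "g \<in> based_loops Y y" and null: "loop_class Y g = \<one>\<^bsub>H1 Y\<^esub>"
    and k: "path k" "path_image k \<subseteq> X" "\<And>t. t \<in> {0..1} \<Longrightarrow> \<pi> (k t) = g t"
  shows "pathfinish k = pathstart k"
proof -
  from ind obtain x where X: "path_connected X" and Y: "path_connected Y" and cov: "covering_space X \<pi> Y"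
    and x: "x \<in> X"
    and iso: "pi1_map Y \<pi> \<in> iso (commutator_subgroup (fundamental_group X x))
                              (commutator_subgroup (fundamental_group Y (\<pi> x)))"
    by (auto simp: inductive_covering_def)
  have c: "continuous_on X \<pi>" "\<pi> ` X \<subseteq> Y"
    using cov by (auto simp: covering_space_def)
  have kends: "pathstart k \<in> X" "pathfinish k \<in> X" using path_ends_in[OF k(2)] by auto
  obtain d where d: "path d" "path_image d \<subseteq> X" "pathstart d = x" "pathfinish d = pathstart k"
    using X x kends(1) unfolding path_connected_def by blast
  let ?d = "\<pi> \<circ> d"
  have pd: "path ?d" "path_image ?d \<subseteq> Y" "pathstart ?d = \<pi> x" "pathfinish ?d = \<pi> (pathstart k)"
    using d path_compose_continuous[OF c d(1,2)] by (simp_all add: pathstart_compose pathfinish_compose)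
  have gy: "path g" "path_image g \<subseteq> Y" "pathstart g = y" "pathfinish g = y"
    using g by (auto simp: based_loops_def)
  have ky: "\<pi> (pathstart k) = y" "\<pi> (pathfinish k) = y"
    using k(3)[of 0] k(3)[of 1] gy by (auto simp: pathstart_def pathfinish_def)
  let ?m = "(?d +++ g) +++ reversepath ?d"
  have m: "?m \<in> based_loops Y (\<pi> x)"
    using pd gy ky by (auto simp: based_loops_def subset_path_image_join)
  have "loop_class Y ?m = \<one>\<^bsub>H1 Y\<^esub>"
  proof -
    let ?h = "homologous_rel 1 (top_of_set Y) {}"
    have "?h (frag_of (path_simplex ?m)) (frag_of (path_simplex (?d +++ g)) + frag_of (path_simplex (reversepath ?d)))"
      using pd gy ky by (intro homologous_join) (auto simp: subset_path_image_join)
    moreover have "?h (frag_of (path_simplex (?d +++ g)) + frag_of (path_simplex (reversepath ?d)))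
       ((frag_of (path_simplex ?d) + frag_of (path_simplex g)) + - frag_of (path_simplex ?d))"
      using pd gy ky by (intro homologous_rel_add homologous_join homologous_reverse) auto
    ultimately have "?h (frag_of (path_simplex ?m)) (frag_of (path_simplex g))"
      using homologous_rel_trans by fastforce
    then show ?thesis
      using null by (simp add: loop_class_def homologous_rel_set_eq[THEN iffD2])
  qed
  then have derived: "path_class Y ?m \<in> derived (fundamental_group Y (\<pi> x)) (carrier (fundamental_group Y (\<pi> x)))"
    by (rule hurewicz_kernel[OF Y m])
  \<comment> \<open>the returning piece: a lift of the reverse of \<open>\<pi> \<circ> d\<close> from the end of \<open>k\<close>, not yet known to retrace \<open>d\<close>\<close>
  obtain r where r: "path r" "path_image r \<subseteq> X" "pathstart r = pathfinish k"
    "\<And>t. t \<in> {0..1} \<Longrightarrow> \<pi> (r t) = reversepath ?d t"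
    by (rule covering_space_path_lifting[OF cov, of "reversepath ?d" "pathfinish k"]) (use pd kends ky in auto)
  have "pathfinish ((d +++ k) +++ r) = x"
  proof (rule inductive_covering_derived_loop_lifts[OF cov x iso m derived])
    show "\<pi> (((d +++ k) +++ r) t) = ?m t" if "t \<in> {0..1}" for t
      using that k(3) r(4) by (auto simp: joinpaths_def)
  qed (use d k r in \<open>auto simp: subset_path_image_join\<close>)
  then have rx: "pathfinish r = x" by simp
  have "reversepath r t = d t" if "t \<in> {0..1}" for t
  proof (rule covering_space_path_lifts_eq[OF cov _ _ _ _ _ _ that])
    show "\<pi> (reversepath r s) = \<pi> (d s)" if "s \<in> {0..1}" for s
      using r(4)[of "1 - s"] that by (simp add: reversepath_def)
  qed (use r d rx in auto)
  from this[of 1] have "pathstart r = pathfinish d"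
    by (simp add: reversepath_def pathfinish_def pathstart_def)
  then show ?thesis using r d by simp
qed

lemma path_in_preimage:
  assumes "path_image k \<subseteq> X" "path_image g \<subseteq> V" "\<And>t. t \<in> {0..1} \<Longrightarrow> \<pi> (k t) = g t"
  shows "path_image k \<subseteq> X \<inter> \<pi> -` V"
  using assms by (auto simp: path_image_def)

text \<open>
  Both directions compare loops at one point \<open>v\<close> of \<open>V\<close>. By surjectivity of the Hurewicz maps, the sum of
  the two images in homology consists of the classes of products of a loop in \<open>V\<close> with the image of a
  loop in \<open>X\<close>, where the base point \<open>p\<close> over \<open>v\<close> is free to choose. A lift of a path in \<open>V\<close> stays in the
  preimage of \<open>V\<close>, so connecting two points over \<open>v\<close> there means finding a loop in \<open>V\<close> whose lift joins
  them.
\<close>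

theorem inductive_covering_preimage_path_connected_iff:
  fixes X :: "'a::topological_space set" and Y V :: "'b::topological_space set"
    and \<pi> :: "'a \<Rightarrow> 'b"
  assumes ind: "inductive_covering X \<pi> Y"
    and V: "V \<subseteq> Y" "path_connected V" "V \<noteq> {}"
  shows "path_connected (X \<inter> \<pi> -` V) \<longleftrightarrow>
    (H1_map V Y id ` carrier (H1 V)) <#>\<^bsub>H1 Y\<^esub> (H1_map X Y \<pi> ` carrier (H1 X)) = carrier (H1 Y)"
proof -
  let ?P = "X \<inter> \<pi> -` V"
  interpret H: comm_group "H1 Y" by simp
  from ind have X: "path_connected X" and Y: "path_connected Y" and cov: "covering_space X \<pi> Y"
    by (auto simp: inductive_covering_def)
  have c: "continuous_on X \<pi>" "\<pi> ` X = Y" "\<pi> ` X \<subseteq> Y"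
    using cov by (auto simp: covering_space_def)
  obtain v where v: "v \<in> V" "v \<in> Y" using V(1,3) by blast
  obtain x where x: "x \<in> X" "\<pi> x = v" using v c by auto
  have j: "H1_map V Y id (loop_class V g) = loop_class Y g" if "g \<in> based_loops V v" for g
    using H1_map_loop_class[of V id Y g v] that V(1) by simp
  have VY: "g \<in> based_loops Y v" if "g \<in> based_loops V v" for g
    using that V(1) by (auto simp: based_loops_def)
  have sum_eq: "(H1_map V Y id ` carrier (H1 V)) <#>\<^bsub>H1 Y\<^esub> (H1_map X Y \<pi> ` carrier (H1 X)) =
    {loop_class Y f \<otimes>\<^bsub>H1 Y\<^esub> loop_class Y (\<pi> \<circ> g) |f g. f \<in> based_loops V v \<and> g \<in> based_loops X p}" (is "?sum = ?loops p")
    if p: "p \<in> X" for p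
  proof -
    have "H1_map X Y \<pi> (loop_class X g) = loop_class Y (\<pi> \<circ> g)" if "g \<in> based_loops X p" for g
      using H1_map_loop_class[OF c(1,3) that] .
    then show ?thesis
      unfolding hurewicz_surjective[OF V(2) v(1)] hurewicz_surjective[OF X p] set_mult_def
      using j by force
  qed
  show ?thesis
  proof
    assume P: "path_connected ?P"
    have "carrier (H1 Y) \<subseteq> ?loops x"
    proof
      fix z assume "z \<in> carrier (H1 Y)"
      then obtain g where g: "g \<in> based_loops Y v" and z: "z = loop_class Y g"
        using hurewicz_surjective[OF Y v(2)] by auto
      then obtain k where k: "path k" "path_image k \<subseteq> X" "pathstart k = x"
        "\<And>t. t \<in> {0..1} \<Longrightarrow> \<pi> (k t) = g t"
        by (auto simp: based_loops_def x elim: covering_space_path_lifting[OF cov _ _ x(1)])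
      have "pathfinish k \<in> ?P" "x \<in> ?P"
        using k(2) k(4)[of 1] g path_ends_in[OF k(2)] x v by (auto simp: based_loops_def pathfinish_def)
      then obtain q where q: "path q" "path_image q \<subseteq> ?P" "pathstart q = pathfinish k" "pathfinish q = x"
        using P unfolding path_connected_def by blast
      have kq: "k +++ q \<in> based_loops X x"
        using k q by (auto simp: based_loops_def subset_path_image_join)
      have "pathfinish (\<pi> \<circ> k) = v"
        using k(4)[of 1] g by (auto simp: based_loops_def pathfinish_def)
      then have \<pi>q: "\<pi> \<circ> q \<in> based_loops V v"
        using q x path_compose_continuous[of ?P \<pi> V q] continuous_on_subset[OF c(1), of ?P]
        by (simp add: based_loops_def pathstart_compose pathfinish_compose image_subset_iff)
      have \<pi>k: "\<pi> \<circ> k \<in> based_loops Y v"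
        using k(3) x \<open>pathfinish (\<pi> \<circ> k) = v\<close> path_compose_continuous[OF c(1,3) k(1,2)]
        by (simp add: based_loops_def pathstart_compose)
      \<comment> \<open>\<open>k +++ q\<close> is a loop in \<open>X\<close>, and it differs from the lift of \<open>g\<close> by \<open>q\<close> only, whose image lies in \<open>V\<close>\<close>
      let ?b = "loop_class Y (\<pi> \<circ> q)"
      have closed: "?b \<in> carrier (H1 Y)" "z \<in> carrier (H1 Y)"
        using loop_class_in_H1[OF VY[OF \<pi>q]] loop_class_in_H1[OF g] z by simp_all
      have "loop_class Y (\<pi> \<circ> k) = z"
        unfolding z by (rule loop_class_cong) (simp add: k)
      then have "loop_class Y (\<pi> \<circ> (k +++ q)) = z \<otimes>\<^bsub>H1 Y\<^esub> ?b"
        using loop_class_join[OF \<pi>k VY[OF \<pi>q]] by (simp add: path_compose_join)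
      also have "\<dots> = ?b \<otimes>\<^bsub>H1 Y\<^esub> z"
        using closed by (rule H.m_comm[rotated])
      finally have "z = loop_class Y (reversepath (\<pi> \<circ> q)) \<otimes>\<^bsub>H1 Y\<^esub> loop_class Y (\<pi> \<circ> (k +++ q))"
        unfolding loop_class_reverse[OF VY[OF \<pi>q]] using H.inv_solve_left[OF closed(2,1)] closed by simp
      then show "z \<in> ?loops x"
        using based_loops_reverse[OF \<pi>q] kq by blast
    qed
    moreover have "?loops x \<subseteq> carrier (H1 Y)"
      using loop_class_in_H1[OF VY] loop_class_in_H1[OF based_loops_image[OF c(1,3)]]
      by (blast intro: H.m_closed)
    ultimately show "?sum = carrier (H1 Y)"
      unfolding sum_eq[OF x(1)] by (rule equalityI[rotated])
  next
    assume sum: "?sum = carrier (H1 Y)"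
    have to_v: "\<exists>q p'. path q \<and> path_image q \<subseteq> ?P \<and> pathstart q = p \<and> pathfinish q = p' \<and> p' \<in> X \<and> \<pi> p' = v"
      if p: "p \<in> ?P" for p
    proof -
      obtain g where g: "path g" "path_image g \<subseteq> V" "pathstart g = \<pi> p" "pathfinish g = v"
        using V(2) p v unfolding path_connected_def by blast
      obtain k where k: "path k" "path_image k \<subseteq> X" "pathstart k = p"
        "\<And>t. t \<in> {0..1} \<Longrightarrow> \<pi> (k t) = g t"
        by (rule covering_space_path_lifting[OF cov g(1), of p]) (use g p V(1) in auto)
      have "\<pi> (pathfinish k) = v" "pathfinish k \<in> X"
        using k(4)[of 1] g path_ends_in[OF k(2)] by (auto simp: pathfinish_def)
      then show ?thesis
        using k path_in_preimage[OF k(2) g(2) k(4)] by blast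
    qed
    have fibre: "\<exists>q. path q \<and> path_image q \<subseteq> ?P \<and> pathstart q = p \<and> pathfinish q = p'"
      if p: "p \<in> X" "\<pi> p = v" and p': "p' \<in> X" "\<pi> p' = v" for p p'
    proof -
      obtain r where r: "path r" "path_image r \<subseteq> X" "pathstart r = p" "pathfinish r = p'"
        using X p p' unfolding path_connected_def by blast
      have \<pi>r: "\<pi> \<circ> r \<in> based_loops Y v"
        using r p p' path_compose_continuous[OF c(1,3) r(1,2)]
        by (simp add: based_loops_def pathstart_compose pathfinish_compose)
      have "loop_class Y (\<pi> \<circ> r) \<in> ?loops p"
        unfolding sum_eq[OF p(1), symmetric] sum by (rule loop_class_in_H1[OF \<pi>r])
      then obtain f g where f: "f \<in> based_loops V v" and g: "g \<in> based_loops X p"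
        and eq: "loop_class Y (\<pi> \<circ> r) = loop_class Y f \<otimes>\<^bsub>H1 Y\<^esub> loop_class Y (\<pi> \<circ> g)" by blast
      have \<pi>g: "\<pi> \<circ> g \<in> based_loops Y v"
        using based_loops_image[OF c(1,3) g] p by simp
      obtain k where k: "path k" "path_image k \<subseteq> X" "pathstart k = p"
        "\<And>t. t \<in> {0..1} \<Longrightarrow> \<pi> (k t) = f t"
        by (rule covering_space_path_lifting[OF cov _ _ p(1), of f]) (use VY[OF f] p in \<open>auto simp: based_loops_def\<close>)
      \<comment> \<open>a null-homologous loop whose lift \<open>?l\<close> from the end of \<open>k\<close> passes through \<open>p\<close> and ends at \<open>p'\<close>; as \<open>?l\<close> is closed, \<open>k\<close> ends at \<open>p'\<close>\<close>
      let ?m = "(reversepath f +++ reversepath (\<pi> \<circ> g)) +++ (\<pi> \<circ> r)"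
      let ?l = "(reversepath k +++ reversepath g) +++ r"
      note loops = based_loops_reverse[OF VY[OF f]] based_loops_reverse[OF \<pi>g] \<pi>r
      have m: "?m \<in> based_loops Y v"
        using loops by (intro based_loops_join)
      have "loop_class Y ?m = (inv\<^bsub>H1 Y\<^esub> loop_class Y f \<otimes>\<^bsub>H1 Y\<^esub> inv\<^bsub>H1 Y\<^esub> loop_class Y (\<pi> \<circ> g))
          \<otimes>\<^bsub>H1 Y\<^esub> (loop_class Y f \<otimes>\<^bsub>H1 Y\<^esub> loop_class Y (\<pi> \<circ> g))"
        using loop_class_join[OF based_loops_join[OF loops(1,2)] loops(3)] loop_class_join[OF loops(1,2)]
        by (simp add: eq loop_class_reverse[OF VY[OF f]] loop_class_reverse[OF \<pi>g])
      also have "\<dots> = \<one>\<^bsub>H1 Y\<^esub>"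
        using loop_class_in_H1[OF VY[OF f]] loop_class_in_H1[OF \<pi>g]
        by (simp add: H.inv_mult[symmetric])
      finally have null: "loop_class Y ?m = \<one>\<^bsub>H1 Y\<^esub>" .
      have "pathfinish ?l = pathstart ?l"
      proof (rule inductive_covering_null_homologous_loop_lifts[OF ind m null])
        show "\<pi> (?l t) = ?m t" if "t \<in> {0..1}" for t
          using that k(4) by (auto simp: joinpaths_def reversepath_def)
      qed (use k g r in \<open>auto simp: based_loops_def subset_path_image_join\<close>)
      then have "pathfinish k = p'" using r by simp
      moreover have "path_image k \<subseteq> ?P"
        by (rule path_in_preimage[where g = f, OF k(2) _ k(4)]) (use f in \<open>simp add: based_loops_def\<close>)
      ultimately show ?thesis using k by blast
    qed
    show "path_connected ?P"
      unfolding path_connected_def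
    proof (intro ballI)
      fix p p' assume "p \<in> ?P" "p' \<in> ?P"
      then obtain q s q' s' where q: "path q" "path_image q \<subseteq> ?P" "pathstart q = p" "pathfinish q = s" "s \<in> X" "\<pi> s = v"
        and q': "path q'" "path_image q' \<subseteq> ?P" "pathstart q' = p'" "pathfinish q' = s'" "s' \<in> X" "\<pi> s' = v"
        using to_v by meson
      obtain w where w: "path w" "path_image w \<subseteq> ?P" "pathstart w = s" "pathfinish w = s'"
        using fibre[OF q(5,6) q'(5,6)] by blast
      show "\<exists>g. path g \<and> path_image g \<subseteq> ?P \<and> pathstart g = p \<and> pathfinish g = p'"
        using q q' w by (intro exI[of _ "(q +++ w) +++ reversepath q'"]) (simp add: subset_path_image_join)
    qed
  qed
qed

theorem theorem1p22:
  fixes X :: "'a::topological_space set" and Y V :: "'b::topological_space set"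
    and \<pi> :: "'a \<Rightarrow> 'b"
  assumes "strongly_inductive_covering X \<pi> Y"
    and "finite_degree X \<pi> Y"
    and "V \<subseteq> Y" and "path_connected V" and "V \<noteq> {}"
  shows "path_connected (X \<inter> \<pi> -` V) \<longleftrightarrow>
    (H1_map V Y id ` carrier (H1 V)) <#>\<^bsub>H1 Y\<^esub> (H1_map X Y \<pi> ` carrier (H1 X)) = carrier (H1 Y)"
  using assms(1,3-5)
  by (intro inductive_covering_preimage_path_connected_iff) (simp_all add: strongly_inductive_covering_def)

end
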